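(* Let $d\ge 1$, let $f$ be a uniformly continuous probability density on $\mathbb{R}^d$, let $X_1,X_2,\dots$ be i.i.d. with density $f$, and let $\mathcal{X}_n=\{X_1,\dots,X_n\}$. Let $r=r_n>0$ be a sequence such that $r_n\to 0$ and $n r_n^d/\log n\to\infty$, and put $N=n\,\omega\, r_n^d$. Then almost surely, $$\frac1N\,\mathrm{C}_{r_n}(x,\mathcal{X}_n)\xrightarrow[n\to\infty]{}\mathrm{C}_0(x,f)\quad\text{uniformly in } x\in\mathbb{R}^d .$$
   Context: $\mathsf{B}(x,r)$ is the closed Euclidean ball of center $x$ and radius $r$, and $\omega$ is the volume of the unit ball of $\mathbb{R}^d$. Discrete coreness: for $x\in\mathbb{R}^d$ and $r>0$, $\mathcal{G}_r(x,\mathcal{X}_n)$ is the (undirected, simple) graph with vertex set $\{x\}\cup\mathcal{X}_n$ in which two distinct points are adjacent iff their Euclidean distance is at most $r$. $\mathrm{C}_r(x,\mathcal{X}_n)$ is the largest integer $\ell$ such that there is a subgraph $H$ of $\mathcal{G}_r(x,\mathcal{X}_n)$ containing the vertex $x$ with $\min_{v\in H}\deg_H(v)\ge \ell$. Continuum coreness: for $r>0$ and a non-negative bounded measurable $\phi:\mathbb{R}^d\to\mathbb{R}$, let $$\mathrm{H}_r\phi(x)=\sup\Big\{t\ge0 : \frac1{\omega r^d}\int_{\mathsf{B}(x,r)}\mathbf{1}_{\phi(z)\ge t}\,f(z)\,dz\ge t\Big\},$$ let $\mathrm{H}_r^k$ be its $k$-th iterate, and let $f_r(x)=\frac{1}{\omega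 r^d}\int_{\mathsf{B}(x,r)}f(z)\,dz$. The continuum $r$-coreness is $\mathrm{C}_r(x,f)=\lim_{k\to\infty}\mathrm{H}_r^kf_r(x)$ and the continuum coreness is $\mathrm{C}_0(x,f)=\lim_{r\to0^+}\mathrm{C}_r(x,f)$ (both limits exist). *)

theory Defs
  imports "HOL-Probability.Probability"
begin

text \<open>A simple undirected graph is a pair of a vertex set and a set of two-element edges.\<close>

type_synonym 'a ugraph = "'a set \<times> 'a set set"

definition subgraph :: "'a ugraph \<Rightarrow> 'a ugraph \<Rightarrow> bool" where
  "subgraph H G \<longleftrightarrow> fst H \<subseteq> fst G \<and> snd H \<subseteq> snd G \<and> (\<forall>e\<in>snd H. e \<subseteq> fst H)"

definition degree :: "'a ugraph \<Rightarrow> 'a \<Rightarrow> nat" where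
  "degree H v = card {e \<in> snd H. v \<in> e}"

definition neighborhood_graph :: "real \<Rightarrow> 'a::metric_space \<Rightarrow> 'a set \<Rightarrow> 'a ugraph" where
  "neighborhood_graph r x S =
     (insert x S, {{u, v} |u v. u \<in> insert x S \<and> v \<in> insert x S \<and> u \<noteq> v \<and> dist u v \<le> r})"

text \<open>
  For finite \<open>S\<close>. Natural numbers suffice for the largest integer: the subgraph with
  the single vertex \<open>x\<close> and no edges always gives \<open>l = 0\<close>.
\<close>

definition discrete_coreness :: "real \<Rightarrow> 'a::metric_space \<Rightarrow> 'a set \<Rightarrow> nat" where
  "discrete_coreness r x S =
     (GREATEST l. \<exists>H. subgraph H (neighborhood_graph r x S) \<and> x \<in> fst H \<and>
        l \<le> (MIN v\<in>fst H. degree H v))"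

text \<open>The volume of the ball of radius \<open>r\<close>, in the form \<open>\<omega> r\<^sup>d\<close>.\<close>

definition ball_volume :: "'a::euclidean_space itself \<Rightarrow> real \<Rightarrow> real" where
  "ball_volume _ r = measure lborel (cball (0::'a) 1) * r ^ DIM('a)"

definition H_op ::
  "real \<Rightarrow> ('a::euclidean_space \<Rightarrow> real) \<Rightarrow> ('a \<Rightarrow> real) \<Rightarrow> 'a \<Rightarrow> real" where
  "H_op r f \<phi> x =
     Sup {t. 0 \<le> t \<and>
       t \<le> 1 / ball_volume TYPE('a) r *
            (LINT z:cball x r|lborel. indicat_real {z. t \<le> \<phi> z} z * f z)}"

definition ball_average :: "real \<Rightarrow> ('a::euclidean_space \<Rightarrow> real) \<Rightarrow> 'a \<Rightarrow> real" where
  "ball_average r f x = 1 / ball_volume TYPE('a) r * (LINT z:cball x r|lborel. f z)"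

definition continuum_r_coreness :: "real \<Rightarrow> ('a::euclidean_space \<Rightarrow> real) \<Rightarrow> 'a \<Rightarrow> real" where
  "continuum_r_coreness r f x = lim (\<lambda>k. (H_op r f ^^ k) (ball_average r f) x)"

definition continuum_coreness :: "('a::euclidean_space \<Rightarrow> real) \<Rightarrow> 'a \<Rightarrow> real" where
  "continuum_coreness f x = Lim (at_right 0) (\<lambda>r. continuum_r_coreness r f x)"

end

theory Submission
  imports Defs
begin

text \<open>
  Both kinds of coreness have a description by certificates. Call a Borel set \<open>S\<close> good for a measure \<open>\<mu>\<close> at
  scale \<open>r\<close> and level \<open>t\<close> if \<open>\<mu> (cball z r \<inter> S) \<ge> t * \<omega> * r ^ d\<close> for every \<open>z \<in> S\<close>. For the law with density
  \<open>f\<close>, the \<open>r\<close>-coreness of \<open>x\<close> is the largest level of a good set that contains \<open>x\<close>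
  (\<open>le_continuum_r_coreness_iff_good_at\<close>). For the empirical measure of \<open>n\<close> distinct points, the normalised
  discrete coreness is that largest level up to \<open>1 / N\<close>: vertex sets of subgraphs are good sets
  (\<open>good_at_discrete_coreness\<close>, \<open>le_discrete_coreness_of_good_at\<close>). So it suffices to turn good sets for one
  measure and scale into good sets for another, with a small loss of level.

  This is possible whenever both measures look, at their small scales, like multiples of Lebesgue measure on
  half-balls (\<open>good_at_transfer\<close>). Thicken \<open>S\<close> by a radius \<open>\<eta>\<close> much larger than both scales, over which \<open>f\<close>
  hardly varies. Interior points of the thickened set see the full density \<open>f\<close>. A point near its boundary sees
  at least a half-ball, that is \<open>f / 2\<close>. In that case \<open>S\<close> has a hole of radius at least \<open>\<eta>\<close> nearby; a point of \<open>S\<close>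
  at the edge of the hole sees at most a half-ball of \<open>S\<close>, so the level was at most about \<open>f / 2\<close> to begin with.

  The law is of this kind because \<open>f\<close> is uniformly continuous. The empirical measure is of this kind as soon as its
  masses on the cells of a grid of side comparable to \<open>r n\<close> are close to those of the law
  (\<open>caps_regular_of_grid_cells\<close>). Chernoff bounds and the Borel--Cantelli lemma yield this almost surely for all
  large \<open>n\<close>, simultaneously for the infinitely many cells (\<open>AE_empirical_close_on_cells\<close>); here the assumption
  \<open>n * r n ^ d / ln n \<rightarrow> \<infinity>\<close> enters.

  Transferring from the law to itself at two small scales shows that the \<open>r\<close>-coreness converges as \<open>r \<rightarrow> 0\<close>.
  Transferring between the law and the empirical measure shows that the normalised discrete coreness
  is close to the limit. All constants are independent of \<open>x\<close>, so the convergence is uniform.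
\<close>

section \<open>Volumes of spherical caps\<close>

lemma ball_volume_eq:
  fixes z :: "'a::euclidean_space"
  assumes "0 \<le> r"
  shows "ball_volume TYPE('a) r = measure lborel (cball z r)"
  using content_cball[OF assms, of z] content_cball[of 1 "0::'a"] assms
  by (simp add: ball_volume_def)

lemma ball_volume_pos: "0 < r \<Longrightarrow> 0 < ball_volume TYPE('a::euclidean_space) r"
  using content_cball_pos[of r "0::'a"] ball_volume_eq[of r "0::'a"] by simp

lemma ball_volume_mult:
  "ball_volume TYPE('a::euclidean_space) (c * r) = c ^ DIM('a) * ball_volume TYPE('a) r"
  by (simp add: ball_volume_def power_mult_distrib)

text \<open>
  The height of the bounding hyperplane is measured in units of the radius, so that caps with the same
  \<open>k\<close> are similar. For small \<open>k > 0\<close> the cap of height \<open>- k\<close> is slightly more, and the cap of height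
  \<open>k\<close> slightly less, than half of the ball.
\<close>

definition cap :: "'a::euclidean_space \<Rightarrow> 'a \<Rightarrow> real \<Rightarrow> real \<Rightarrow> 'a set" where
  "cap z u r k = {w \<in> cball z r. k * r \<le> (w - z) \<bullet> u}"

lemma cap_measurable [measurable]: "cap z u r k \<in> sets borel"
proof -
  have "closed (cball z r \<inter> {w. k * r \<le> (w - z) \<bullet> u})"
    by (intro closed_Int closed_cball closed_Collect_le continuous_intros)
  moreover have "cap z u r k = cball z r \<inter> {w. k * r \<le> (w - z) \<bullet> u}"
    by (auto simp: cap_def)
  ultimately show ?thesis by (simp add: borel_closed)
qed

lemma bounded_borel_fmeasurable:
  fixes A :: "'a::euclidean_space set"
  assumes "A \<in> sets borel" "A \<subseteq> cball z r"
  shows "A \<in> fmeasurable lborel"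
  using assms bounded_subset[OF bounded_cball assms(2)] emeasure_bounded_finite[of A]
  by (simp add: fmeasurable_def)

lemma cap_fmeasurable: "cap z u r k \<in> fmeasurable lborel"
  by (rule bounded_borel_fmeasurable[of _ z r]) (auto simp: cap_def)

lemma measure_lborel_reflect:
  fixes A :: "'a::euclidean_space set"
  assumes [measurable]: "A \<in> sets borel"
  shows "measure lborel ((\<lambda>w. a - w) -` A) = measure lborel A"
proof -
  have T: "(\<lambda>x. a + (\<Sum>j\<in>Basis. (- 1 * (x \<bullet> j)) *\<^sub>R j)) = (\<lambda>x::'a. a - x)"
    by (rule ext) (simp add: sum_negf euclidean_representation)
  have "lborel = density (distr lborel borel (\<lambda>x::'a. a - x)) (\<lambda>_. (\<Prod>j\<in>(Basis::'a set). \<bar>-1::real\<bar>))"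
    using lborel_affine_euclidean[of "\<lambda>_::'a. -1" a] unfolding T by simp
  then have L: "lborel = distr lborel borel (\<lambda>x::'a. a - x)"
    by (simp add: density_1)
  have "measure lborel A = measure (distr lborel borel (\<lambda>x::'a. a - x)) A"
    using L by simp
  also have "\<dots> = measure lborel ((\<lambda>w. a - w) -` A)"
    by (subst measure_distr) auto
  finally show ?thesis by simp
qed

lemma measure_lborel_translate:
  fixes A :: "'a::euclidean_space set"
  assumes [measurable]: "A \<in> sets borel"
  shows "measure lborel ((\<lambda>w. w - a) -` A) = measure lborel A"
proof -
  have 1: "(\<lambda>w. 0 - w) -` ((\<lambda>w. - a - w) -` A) = (\<lambda>w. w - a) -` A"
    by (auto simp: algebra_simps)
  have [measurable]: "(\<lambda>w. - a - w) -` A \<in> sets borel"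
    using measurable_sets_borel[of "\<lambda>w. -a - w" borel A] by simp
  have "measure lborel ((\<lambda>w. 0 - w) -` ((\<lambda>w. - a - w) -` A)) = measure lborel ((\<lambda>w. - a - w) -` A)"
    by (rule measure_lborel_reflect) simp
  then show ?thesis
    using measure_lborel_reflect[OF assms, of "-a"] unfolding 1 by simp
qed

text \<open>
  Translates of the slab by the multiples \<open>j * (3 * k * r)\<close>, \<open>j \<le> m\<close>, of the normal vector are
  disjoint, and for \<open>3 * k * m \<le> 1\<close> they all lie in the ball of radius \<open>2 * r\<close>. Unlike a
  computation in coordinates, this bounds the slab uniformly in its direction.
\<close>

lemma measure_slab_le:
  fixes z u :: "'a::euclidean_space"
  assumes u: "norm u = 1" and r: "0 < r" and k: "0 < k" "3 * k * real m \<le> 1"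
  shows "real (Suc m) * measure lborel (cap z u r (- k) \<inter> cap z (- u) r (- k))
      \<le> 2 ^ DIM('a) * ball_volume TYPE('a) r"
proof -
  define T where "T = cap z u r (- k) \<inter> cap z (- u) r (- k)"
  have Tm[measurable]: "T \<in> sets borel" by (simp add: T_def sets.Int)
  define D where "D j = (\<lambda>w. w - (real j * (3 * k * r)) *\<^sub>R u) -` T" for j
  have Dm[measurable]: "D j \<in> sets borel" for j
    unfolding D_def by (rule measurable_sets_borel[of _ borel]) auto
  have inD: "\<bar>(w - z) \<bullet> u - real j * (3 * k * r)\<bar> \<le> k * r" if "w \<in> D j" for w j
  proof -
    have "- (k * r) \<le> (w - (real j * (3 * k * r)) *\<^sub>R u - z) \<bullet> u"
         "(w - (real j * (3 * k * r)) *\<^sub>R u - z) \<bullet> u \<le> k * r"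
      using that by (auto simp: D_def T_def cap_def)
    moreover have "(w - (real j * (3 * k * r)) *\<^sub>R u - z) \<bullet> u = (w - z) \<bullet> u - real j * (3 * k * r)"
      using u by (simp add: inner_diff_left dot_square_norm)
    ultimately show ?thesis by (simp add: abs_le_iff)
  qed
  have disj: "disjoint_family_on D {..m}"
    unfolding disjoint_family_on_def
  proof (intro ballI impI)
    fix i j :: nat assume ij: "i \<noteq> j"
    show "D i \<inter> D j = {}"
    proof (rule ccontr)
      assume "D i \<inter> D j \<noteq> {}"
      then obtain w where w: "w \<in> D i" "w \<in> D j" by auto
      have "\<bar>real i * (3 * k * r) - real j * (3 * k * r)\<bar> \<le> 2 * (k * r)"
        using inD[OF w(1)] inD[OF w(2)] by linarith
      moreover have "\<bar>real i * (3 * k * r) - real j * (3 * k * r)\<bar> = \<bar>real i - real j\<bar> * (3 * (k * r))"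
      proof -
        have "real i * (3 * k * r) - real j * (3 * k * r) = (real i - real j) * (3 * (k * r))"
          by (simp add: algebra_simps)
        then show ?thesis using k r by (simp add: abs_mult)
      qed
      moreover have "1 * (3 * (k * r)) \<le> \<bar>real i - real j\<bar> * (3 * (k * r))"
        using ij k r by (intro mult_right_mono) auto
      moreover have "0 < k * r" using k r by simp
      ultimately show False by linarith
    qed
  qed
  have sub: "D j \<subseteq> cball z (2 * r)" if "j \<le> m" for j
  proof
    fix w assume w: "w \<in> D j"
    then have "norm (w - (real j * (3 * k * r)) *\<^sub>R u - z) \<le> r"
      by (auto simp: D_def T_def cap_def dist_norm norm_minus_commute)
    moreover have "norm ((real j * (3 * k * r)) *\<^sub>R u) \<le> r"
    proof -
      have "real j * (3 * k * r) \<le> real m * (3 * k * r)"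
        using that k r by (intro mult_right_mono) auto
      also have "\<dots> \<le> 1 * r" using k r mult_right_mono[OF k(2), of r] by (simp add: mult_ac)
      finally show ?thesis using u k r by simp
    qed
    moreover have "norm (w - z) \<le> norm (w - (real j * (3 * k * r)) *\<^sub>R u - z) + norm ((real j * (3 * k * r)) *\<^sub>R u)"
      using norm_triangle_ineq[of "w - (real j * (3 * k * r)) *\<^sub>R u - z" "(real j * (3 * k * r)) *\<^sub>R u"]
      by (simp add: algebra_simps)
    ultimately show "w \<in> cball z (2 * r)" by (simp add: dist_norm norm_minus_commute)
  qed
  have fin: "D j \<in> fmeasurable lborel" if "j \<le> m" for j
    using sub[OF that] by (intro bounded_borel_fmeasurable) auto
  have "real (Suc m) * measure lborel T = (\<Sum>j\<le>m. measure lborel (D j))"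
    unfolding D_def by (simp add: measure_lborel_translate)
  also have "\<dots> = measure lborel (\<Union>j\<le>m. D j)"
    using fin by (intro measure_finite_Union[symmetric] disj) (auto dest: fmeasurableD2)
  also have "\<dots> \<le> measure lborel (cball z (2 * r))"
    using sub by (intro measure_mono_fmeasurable bounded_borel_fmeasurable[of _ z "2*r"]) auto
  also have "\<dots> = 2 ^ DIM('a) * ball_volume TYPE('a) r"
    using r by (simp add: ball_volume_eq[of "2*r" z, symmetric] ball_volume_mult)
  finally show ?thesis by (simp add: T_def)
qed

lemma measure_cap_reflect:
  "measure lborel (cap z (- u) r k) = measure lborel (cap z u r k)"
proof -
  have "(\<lambda>w. 2 *\<^sub>R z - w) -` cap z u r k = cap z (- u) r k"
  proof -
    have "(2 *\<^sub>R z - w - z) \<bullet> u = - ((w - z) \<bullet> u)" for w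
      by (simp add: scaleR_2 inner_diff_left)
    moreover have "dist z (2 *\<^sub>R z - w) = dist z w" for w
      by (simp add: dist_norm scaleR_2 norm_minus_commute)
    ultimately show ?thesis by (auto simp: cap_def)
  qed
  then show ?thesis using measure_lborel_reflect[OF cap_measurable, of "2 *\<^sub>R z" z u r k] by simp
qed

text \<open>
  Reflection exchanges the two caps cut off by the hyperplanes at height \<open>- k * r\<close>; they cover the
  ball and overlap in the thin slab, so each of them is about half of the ball.
\<close>

lemma cap_volume:
  assumes "0 < \<theta>"
  obtains k0 where "0 < k0"
    "\<And>k r (z::'a::euclidean_space) u. \<lbrakk>0 < k; k \<le> k0; 0 < r; norm u = 1\<rbrakk> \<Longrightarrow>
      measure lborel (cap z u r (- k)) \<le> ball_volume TYPE('a) r * ((1 + \<theta>) / 2) \<and>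
      ball_volume TYPE('a) r * ((1 - \<theta>) / 2) \<le> measure lborel (cap z u r k)"
proof -
  obtain m :: nat where m: "2 ^ DIM('a) / \<theta> < real m" using reals_Archimedean2 by blast
  have mpos: "0 < real m" using m assms by (smt (verit) divide_pos_pos zero_less_power)
  define k0 where "k0 = 1 / (3 * real m)"
  show ?thesis
  proof (rule that[of k0])
    show "0 < k0" using mpos by (simp add: k0_def)
    fix k r :: real and z u :: 'a
    assume k: "0 < k" "k \<le> k0" and r: "0 < r" and u: "norm u = 1"
    let ?V = "ball_volume TYPE('a) r"
    have Vp: "0 < ?V" using r by (rule ball_volume_pos)
    let ?P = "cap z u r (- k)" let ?P' = "cap z (- u) r (- k)"
    have "3 * k * real m \<le> 1" using k mpos by (simp add: k0_def field_simps)
    from measure_slab_le[OF u r k(1) this, of z]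
    have "real m * measure lborel (?P \<inter> ?P') \<le> 2 ^ DIM('a) * ?V"
      by (simp add: algebra_simps) (smt (verit) measure_nonneg)
    also have "\<dots> \<le> (real m * \<theta>) * ?V"
      using m assms Vp by (intro mult_right_mono) (auto simp: field_simps)
    finally have slab: "measure lborel (?P \<inter> ?P') \<le> \<theta> * ?V"
      using mpos by (simp add: mult.assoc)
    have kr: "0 < k * r" using k r by simp
    have un: "?P \<union> ?P' = cball z r"
    proof -
      have "- (k * r) \<le> x \<or> x \<le> k * r" for x using kr by linarith
      then show ?thesis by (auto simp: cap_def)
    qed
    have "?V = measure lborel (?P \<union> ?P')" using ball_volume_eq[of r z] r un by simp
    also have "\<dots> = measure lborel ?P + measure lborel ?P' - measure lborel (?P \<inter> ?P')"
      by (intro measure_Un3 cap_fmeasurable)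
    finally have P: "measure lborel ?P \<le> ?V * ((1 + \<theta>) / 2)"
      using slab by (simp add: measure_cap_reflect algebra_simps)
    have "cball z r \<subseteq> cap z u r k \<union> ?P'" by (auto simp: cap_def)
    then have "?V \<le> measure lborel (cap z u r k \<union> ?P')"
      using r by (simp add: ball_volume_eq[of r z])
        (intro measure_mono_fmeasurable fmeasurable.Un cap_fmeasurable, auto)
    also have "\<dots> \<le> measure lborel (cap z u r k) + measure lborel ?P'"
      by (intro measure_Un_le) (use cap_measurable in auto)
    finally have "?V * ((1 - \<theta>) / 2) \<le> measure lborel (cap z u r k)"
      using P by (simp add: measure_cap_reflect field_simps)
    with P show "measure lborel ?P \<le> ?V * ((1 + \<theta>) / 2) \<and> ?V * ((1 - \<theta>) / 2) \<le> measure lborel (cap z u r k)"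
      by simp
  qed
qed

section \<open>Good sets and their transfer between scales and measures\<close>

text \<open>
  A set \<open>S\<close> as in this definition is a certificate for coreness at least \<open>t\<close> at all of its points:
  at scale \<open>r\<close>, every point of \<open>S\<close> sees normalised \<open>\<mu>\<close>-mass at least \<open>t\<close> inside \<open>S\<close>. The
  definition makes sense for the law with density \<open>f\<close> and for the empirical measure of the sample alike.
\<close>

definition good_at :: "'a::euclidean_space measure \<Rightarrow> real \<Rightarrow> real \<Rightarrow> 'a \<Rightarrow> bool" where
  "good_at \<mu> r t x \<longleftrightarrow> (\<exists>S\<in>sets borel. x \<in> S \<and>
     (\<forall>z\<in>S. t * ball_volume TYPE('a) r \<le> measure \<mu> (cball z r \<inter> S)))"

text \<open>
  At scale \<open>r\<close> the measure behaves as if it had the constant density \<open>f z\<close> near \<open>z\<close>, up to an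
  error \<open>\<delta>\<close>. Half-balls are all that has to be measured; the mass of a full ball
  follows, because two opposite caps of height \<open>- k\<close> cover it and two of height \<open>k\<close> are disjoint.
\<close>

definition caps_regular ::
  "('a::euclidean_space \<Rightarrow> real) \<Rightarrow> 'a measure \<Rightarrow> real \<Rightarrow> real \<Rightarrow> real \<Rightarrow> bool" where
  "caps_regular f \<mu> r k \<delta> \<longleftrightarrow> (\<forall>z u. norm u = 1 \<longrightarrow>
     measure \<mu> (cap z u r (- k)) \<le> ball_volume TYPE('a) r * (f z / 2 + \<delta>) \<and>
     ball_volume TYPE('a) r * (f z / 2 - \<delta>) \<le> measure \<mu> (cap z u r k))"

lemma caps_regularD:
  fixes \<mu> :: "'a::euclidean_space measure"
  assumes "caps_regular f \<mu> r k \<delta>" "norm u = 1"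
  shows "measure \<mu> (cap z u r (- k)) \<le> ball_volume TYPE('a) r * (f z / 2 + \<delta>)"
    and "ball_volume TYPE('a) r * (f z / 2 - \<delta>) \<le> measure \<mu> (cap z u r k)"
  using assms by (auto simp: caps_regular_def)

lemma ex_unit_vector: "\<exists>u::'a::euclidean_space. norm u = 1"
  using norm_Basis nonempty_Basis by blast

lemma caps_regular_cball_le:
  fixes \<mu> :: "'a::euclidean_space measure"
  assumes "finite_measure \<mu>" and [measurable_cong]: "sets \<mu> = sets borel"
    and reg: "caps_regular f \<mu> r k \<delta>" and k: "0 < k" and r: "0 < r"
  shows "measure \<mu> (cball z r) \<le> ball_volume TYPE('a) r * (f z + 2 * \<delta>)"
proof -
  interpret finite_measure \<mu> by fact
  obtain u :: 'a where u: "norm u = 1" using ex_unit_vector by blast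
  have kr: "0 < k * r" using k r by simp
  have "cball z r \<subseteq> cap z u r (- k) \<union> cap z (- u) r (- k)"
  proof -
    have "- (k * r) \<le> x \<or> x \<le> k * r" for x using kr by linarith
    then show ?thesis by (auto simp: cap_def)
  qed
  then have "measure \<mu> (cball z r) \<le> measure \<mu> (cap z u r (- k) \<union> cap z (- u) r (- k))"
    by (intro finite_measure_mono) (auto simp: assms(2) cap_measurable)
  also have "\<dots> \<le> measure \<mu> (cap z u r (- k)) + measure \<mu> (cap z (- u) r (- k))"
    by (intro measure_Un_le) (auto simp: assms(2) cap_measurable)
  also have "\<dots> \<le> ball_volume TYPE('a) r * (f z / 2 + \<delta>) + ball_volume TYPE('a) r * (f z / 2 + \<delta>)"
    by (intro add_mono caps_regularD[OF reg]) (simp_all add: u)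
  finally show ?thesis by (simp add: algebra_simps)
qed

lemma caps_regular_cball_ge:
  fixes \<mu> :: "'a::euclidean_space measure"
  assumes "finite_measure \<mu>" and "sets \<mu> = sets borel"
    and reg: "caps_regular f \<mu> r k \<delta>" and k: "0 < k" and r: "0 < r"
  shows "ball_volume TYPE('a) r * (f z - 2 * \<delta>) \<le> measure \<mu> (cball z r)"
proof -
  interpret finite_measure \<mu> by fact
  obtain u :: 'a where u: "norm u = 1" using ex_unit_vector by blast
  have kr: "0 < k * r" using k r by simp
  have "ball_volume TYPE('a) r * (f z / 2 - \<delta>) + ball_volume TYPE('a) r * (f z / 2 - \<delta>)
      \<le> measure \<mu> (cap z u r k) + measure \<mu> (cap z (- u) r k)"
    by (intro add_mono caps_regularD[OF reg]) (simp_all add: u)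
  also have "\<dots> = measure \<mu> (cap z u r k \<union> cap z (- u) r k)"
    using kr by (intro finite_measure_Union[symmetric]) (auto simp: assms(2) cap_measurable, auto simp: cap_def)
  also have "\<dots> \<le> measure \<mu> (cball z r)"
    by (intro finite_measure_mono) (auto simp: assms(2), auto simp: cap_def)
  finally show ?thesis by (simp add: algebra_simps)
qed

text \<open>
  Seen from an almost nearest point \<open>z\<close> of \<open>S\<close> to a point \<open>y\<close> at distance much larger than \<open>r\<close>,
  the sphere that bounds the hole of \<open>S\<close> around \<open>y\<close> is nearly flat: \<open>S\<close> lies on one side of it.
\<close>

lemma hole_in_cap:
  fixes z y :: "'a::euclidean_space"
  assumes hole: "\<And>w. w \<in> S \<Longrightarrow> \<rho> \<le> dist y w" and \<rho>: "0 < \<rho>" and z: "z \<in> S"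
    and near: "dist y z \<le> \<rho> + k * r / 4" and r: "0 < r" "r \<le> k * \<rho>" and k: "0 < k"
  shows "cball z r \<inter> S \<subseteq> cap z ((z - y) /\<^sub>R norm (z - y)) r (- k)"
proof
  fix w assume w: "w \<in> cball z r \<inter> S"
  define D where "D = norm (z - y)"
  have D: "\<rho> \<le> D" "D \<le> \<rho> + k * r / 4"
    using hole[OF z] near by (auto simp: D_def dist_norm norm_minus_commute)
  have Dp: "0 < D" using D \<rho> by linarith
  have "\<rho>\<^sup>2 \<le> (norm (w - y))\<^sup>2"
    using hole[of w] w \<rho> by (intro power_mono) (auto simp: dist_norm norm_minus_commute)
  also have "\<dots> = (norm (w - z))\<^sup>2 + 2 * ((w - z) \<bullet> (z - y)) + D\<^sup>2"
  proof -
    have "(norm (a + b))\<^sup>2 = (norm a)\<^sup>2 + 2 * (a \<bullet> b) + (norm b)\<^sup>2" for a b :: 'a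
      unfolding power2_norm_eq_inner by (simp add: inner_add_left inner_add_right inner_commute)
    from this[of "w - z" "z - y"] show ?thesis by (simp add: D_def)
  qed
  also have "(norm (w - z))\<^sup>2 \<le> r\<^sup>2"
    using w by (intro power_mono) (auto simp: dist_norm norm_minus_commute)
  finally have 1: "\<rho>\<^sup>2 - D\<^sup>2 - r\<^sup>2 \<le> 2 * ((w - z) \<bullet> (z - y))" by simp
  have "D\<^sup>2 - \<rho>\<^sup>2 = (D - \<rho>) * (D + \<rho>)" by (simp add: power2_eq_square algebra_simps)
  also have "\<dots> \<le> (k * r / 4) * (2 * D)" using D \<rho> by (intro mult_mono) auto
  finally have 2: "D\<^sup>2 - \<rho>\<^sup>2 \<le> (k * r * D) / 2" by (simp add: mult_ac)
  have "r * r \<le> r * (k * D)"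
    using r k order_trans[OF r(2) mult_left_mono[OF D(1) less_imp_le[OF k]]] by (intro mult_left_mono) auto
  then have "r\<^sup>2 \<le> k * r * D" by (simp add: power2_eq_square mult_ac)
  with 1 2 have "- (2 * (k * r * D)) \<le> 2 * ((w - z) \<bullet> (z - y))"
    using mult_pos_pos[OF mult_pos_pos[OF k r(1)] Dp] by linarith
  then have "(- k * r) * D \<le> (w - z) \<bullet> (z - y)" by (simp add: mult_ac)
  then have "- k * r \<le> ((w - z) \<bullet> (z - y)) / D" using Dp by (simp add: pos_le_divide_eq)
  then show "w \<in> cap z ((z - y) /\<^sub>R norm (z - y)) r (- k)"
    using w by (simp add: cap_def D_def divide_inverse mult.commute)
qed

text \<open>
  Conversely, the sphere of a ball of radius \<open>\<eta>\<close> much larger than \<open>s\<close> is nearly flat at scale \<open>s\<close>,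
  so from any of its points almost half of the small ball lies inside.
\<close>

lemma cap_in_ball:
  fixes z z0 :: "'a::euclidean_space"
  assumes "dist z0 z < \<eta>" and s: "0 < s" "s \<le> k * \<eta>" "s < \<eta> / 2" and k: "0 < k"
  obtains u where "norm u = 1" "cap z u s k \<subseteq> ball z0 \<eta>"
proof (cases "dist z0 z < \<eta> / 2")
  case True
  have "cap z u s k \<subseteq> ball z0 \<eta>" for u
  proof
    fix w assume "w \<in> cap z u s k"
    then have "dist z w \<le> s" by (simp add: cap_def)
    then show "w \<in> ball z0 \<eta>" using True s(3) dist_triangle[of z0 w z] by simp
  qed
  with ex_unit_vector that show ?thesis by blast
next
  case False
  define D where "D = norm (z0 - z)"
  have D: "\<eta> / 2 \<le> D" "D < \<eta>" using False assms(1) by (auto simp: D_def dist_norm)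
  have Dp: "0 < D" using D s by linarith
  show ?thesis
  proof (rule that[of "(z0 - z) /\<^sub>R D"])
    show "norm ((z0 - z) /\<^sub>R D) = 1" using Dp unfolding D_def by simp
    show "cap z ((z0 - z) /\<^sub>R D) s k \<subseteq> ball z0 \<eta>"
    proof
      fix w assume w: "w \<in> cap z ((z0 - z) /\<^sub>R D) s k"
      have "k * s \<le> ((w - z) \<bullet> (z0 - z)) / D" using w by (simp add: cap_def divide_inverse mult.commute)
      then have 1: "k * s * D \<le> (w - z) \<bullet> (z0 - z)" using Dp by (simp add: pos_le_divide_eq)
      have "(norm (w - z0))\<^sup>2 = (norm (w - z))\<^sup>2 - 2 * ((w - z) \<bullet> (z0 - z)) + D\<^sup>2"
      proof -
        have "w - z0 = (w - z) - (z0 - z)" by simp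
        then show ?thesis unfolding D_def power2_norm_eq_inner
          by (simp add: inner_diff_left inner_diff_right inner_commute)
      qed
      also have "(norm (w - z))\<^sup>2 \<le> s\<^sup>2"
        using w by (intro power_mono) (auto simp: cap_def dist_norm norm_minus_commute)
      also have "s\<^sup>2 - 2 * ((w - z) \<bullet> (z0 - z)) + D\<^sup>2 \<le> D\<^sup>2"
      proof -
        have "s * s \<le> s * (2 * k * D)"
        proof (rule mult_left_mono)
          have "k * \<eta> \<le> k * (2 * D)" using D k by (intro mult_left_mono) auto
          then show "s \<le> 2 * k * D" using s by simp
        qed (use s in simp)
        then show ?thesis using 1 by (simp add: power2_eq_square mult_ac)
      qed
      finally have "norm (w - z0) \<le> D" using Dp by (simp add: power2_le_iff_abs_le)
      then show "w \<in> ball z0 \<eta>" using D by (simp add: dist_norm norm_minus_commute)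
    qed
  qed
qed

text \<open>
  The geometric heart of the proof. Thicken a certificate \<open>S\<close> to \<open>S'\<close>, the union of the balls of radius
  \<open>\<eta>\<close> around its points, where \<open>\<eta>\<close> is large compared with both scales but so small that \<open>f\<close> hardly
  varies over distance \<open>4 * \<eta>\<close>. A point \<open>z'\<close> of \<open>S'\<close> whose ball of radius \<open>s\<close> lies in \<open>S'\<close> sees
  \<open>f z'\<close>, which is at least \<open>t\<close> up to errors, since no point of \<open>S\<close> can see more than the full
  ball. Otherwise some \<open>y\<close> near \<open>z'\<close> is the centre of a hole in \<open>S\<close> of radius at least \<open>\<eta>\<close>. A point of
  \<open>S\<close> next to that hole sees at most a half-ball of \<open>S\<close>, which forces \<open>t \<le> f / 2\<close> there up to errors,
  and \<open>z'\<close> does see a half-ball, because it lies in a ball of radius \<open>\<eta>\<close> contained in \<open>S'\<close>.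
\<close>

lemma good_at_transfer:
  fixes \<mu> \<nu> :: "'a::euclidean_space measure"
  assumes \<mu>: "finite_measure \<mu>" "sets \<mu> = sets borel" "caps_regular f \<mu> r k \<delta>"
    and \<nu>: "finite_measure \<nu>" "sets \<nu> = sets borel" "caps_regular f \<nu> s k \<delta>"
    and osc: "\<And>x y. dist x y < 4 * \<eta> \<Longrightarrow> \<bar>f x - f y\<bar> \<le> \<delta>"
    and k: "0 < k" "k \<le> 1" and \<delta>: "0 \<le> \<delta>"
    and r: "0 < r" "r \<le> k * \<eta>" and s: "0 < s" "s \<le> k * \<eta>" "s < \<eta> / 2"
    and good: "good_at \<mu> r t x"
  shows "good_at \<nu> s (t - 5 * \<delta>) x"
proof -
  interpret \<mu>: finite_measure \<mu> by fact
  interpret \<nu>: finite_measure \<nu> by fact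
  let ?V = "ball_volume TYPE('a)"
  obtain S where S: "S \<in> sets borel" "x \<in> S" and dens: "\<And>z. z \<in> S \<Longrightarrow> t * ?V r \<le> measure \<mu> (cball z r \<inter> S)"
    using good by (auto simp: good_at_def)
  define S' where "S' = (\<Union>z\<in>S. ball z \<eta>)"
  have S'm: "S' \<in> sets borel" by (auto simp: S'_def intro!: borel_open)
  have \<eta>: "0 < \<eta>" using s by linarith
  have Vr: "0 < ?V r" "0 < ?V s" using r s by (auto intro: ball_volume_pos)
  have main: "(t - 5 * \<delta>) * ?V s \<le> measure \<nu> (cball z' s \<inter> S')" if z': "z' \<in> S'" for z'
  proof -
    obtain z0 where z0: "z0 \<in> S" "dist z0 z' < \<eta>" using z' by (auto simp: S'_def)
    show ?thesis
    proof (cases "cball z' s \<subseteq> S'")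
      case True
      have "t * ?V r \<le> measure \<mu> (cball z0 r)"
        using dens[OF z0(1)] by (rule order_trans) (intro \<mu>.finite_measure_mono, auto simp: \<mu>(2))
      also have "\<dots> \<le> ?V r * (f z0 + 2 * \<delta>)"
        using caps_regular_cball_le[OF \<mu> k(1) r(1)] .
      finally have "t \<le> f z0 + 2 * \<delta>" using Vr by (simp add: mult.commute)
      moreover have "\<bar>f z0 - f z'\<bar> \<le> \<delta>" using z0 \<eta> by (intro osc) auto
      ultimately have "t - 5 * \<delta> \<le> f z' - 2 * \<delta>" by linarith
      then have "(t - 5 * \<delta>) * ?V s \<le> ?V s * (f z' - 2 * \<delta>)"
        using Vr by (simp add: mult.commute)
      also have "\<dots> \<le> measure \<nu> (cball z' s)"
        by (rule caps_regular_cball_ge[OF \<nu> k(1) s(1)])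
      also have "cball z' s = cball z' s \<inter> S'" using True by auto
      finally show ?thesis .
    next
      case False
      then obtain y where y: "y \<in> cball z' s" "y \<notin> S'" by blast
      define \<rho> where "\<rho> = infdist y S"
      have Sne: "S \<noteq> {}" using S by auto
      have far: "\<eta> \<le> dist y w" if "w \<in> S" for w
        using y(2) that by (force simp: S'_def dist_commute)
      have \<rho>: "\<eta> \<le> \<rho>" unfolding \<rho>_def infdist_def using Sne far by (auto intro!: cINF_greatest)
      have kr: "0 < k * r / 4" using k r by simp
      \<comment> \<open>\<open>S\<close> need not be closed, so the distance to \<open>y\<close> is attained only approximately.\<close>
      obtain z where z: "z \<in> S" "dist y z < \<rho> + k * r / 4"
      proof -
        have "infdist y S < \<rho> + k * r / 4" using kr by (simp add: \<rho>_def)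
        then obtain z where "z \<in> S" "dist y z < \<rho> + k * r / 4"
          using Sne by (auto simp: infdist_def cINF_less_iff)
        then show ?thesis by (rule that)
      qed
      define u where "u = (z - y) /\<^sub>R norm (z - y)"
      have "z \<noteq> y" using far[OF z(1)] \<eta> by auto
      then have u: "norm u = 1" by (simp add: u_def)
      have "r \<le> k * \<rho>" using order_trans[OF r(2) mult_left_mono[OF \<rho> less_imp_le[OF k(1)]]] .
      then have "cball z r \<inter> S \<subseteq> cap z u r (- k)"
        unfolding u_def using z \<rho> \<eta> r k
        by (intro hole_in_cap[of S \<rho> y z k r]) (auto simp: \<rho>_def intro: infdist_le)
      then have "measure \<mu> (cball z r \<inter> S) \<le> measure \<mu> (cap z u r (- k))"
        by (intro \<mu>.finite_measure_mono) (auto simp: \<mu>(2) cap_measurable)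
      also have "\<dots> \<le> ?V r * (f z / 2 + \<delta>)" by (rule caps_regularD(1)[OF \<mu>(3) u])
      finally have "t * ?V r \<le> ?V r * (f z / 2 + \<delta>)" using dens[OF z(1)] by linarith
      then have t: "t \<le> f z / 2 + \<delta>" using Vr by (simp add: mult.commute)
      have "dist z z' < 4 * \<eta>"
      proof -
        have "\<rho> \<le> dist y z0" using z0 by (simp add: \<rho>_def infdist_le)
        also have "\<dots> \<le> dist y z' + dist z' z0" by (rule dist_triangle)
        finally have "\<rho> < s + \<eta>" using y(1) z0(2) by (simp add: dist_commute)
        moreover have "k * r \<le> 1 * r" using k r by (intro mult_right_mono) auto
        moreover have "r \<le> \<eta>" using r(2) mult_right_mono[OF k(2) less_imp_le[OF \<eta>]] by simp
        moreover have "dist z z' \<le> dist y z + dist y z'" by (rule dist_triangle3)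
        moreover have "dist y z' \<le> s" using y(1) by (simp add: dist_commute)
        ultimately show ?thesis using z(2) s(3) \<eta> by linarith
      qed
      then have "\<bar>f z - f z'\<bar> \<le> \<delta>" by (rule osc)
      then have "t - 5 * \<delta> \<le> f z' / 2 - \<delta>" using t \<delta> by linarith
      then have 1: "(t - 5 * \<delta>) * ?V s \<le> ?V s * (f z' / 2 - \<delta>)" using Vr by (simp add: mult.commute)
      obtain v where v: "norm v = 1" "cap z' v s k \<subseteq> ball z0 \<eta>"
        using cap_in_ball[OF z0(2) s k(1)] by blast
      have "?V s * (f z' / 2 - \<delta>) \<le> measure \<nu> (cap z' v s k)"
        by (rule caps_regularD(2)[OF \<nu>(3) v(1)])
      also have "\<dots> \<le> measure \<nu> (cball z' s \<inter> S')"
      proof (rule \<nu>.finite_measure_mono)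
        show "cap z' v s k \<subseteq> cball z' s \<inter> S'"
          using v(2) z0(1) by (auto simp: S'_def cap_def)
      qed (use S'm in \<open>auto simp: \<nu>(2)\<close>)
      finally show ?thesis using 1 by linarith
    qed
  qed
  have "x \<in> S'" using S \<eta> by (auto simp: S'_def intro!: bexI[of _ x])
  with S'm main show ?thesis unfolding good_at_def by blast
qed

section \<open>Comparing measures through a grid\<close>

text \<open>
  The integer coordinates of a cell are coded as one natural number, so that the cells form a disjoint
  sequence to which countable additivity applies directly.
\<close>

definition grid_index :: "real \<Rightarrow> 'a::euclidean_space \<Rightarrow> nat" where
  "grid_index h w = to_nat (map (\<lambda>b. \<lfloor>w \<bullet> b / h\<rfloor>) (SOME bs. set bs = (Basis :: 'a set)))"

definition grid_cell :: "real \<Rightarrow> nat \<Rightarrow> 'a::euclidean_space set" where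
  "grid_cell h j = {w. grid_index h w = j}"

lemma grid_index_eq_iff:
  fixes w w' :: "'a::euclidean_space"
  shows "grid_index h w = grid_index h w' \<longleftrightarrow> (\<forall>b\<in>Basis. \<lfloor>w \<bullet> b / h\<rfloor> = \<lfloor>w' \<bullet> b / h\<rfloor>)"
proof -
  have "set (SOME bs. set bs = (Basis :: 'a set)) = Basis"
    using someI_ex[OF finite_list[OF finite_Basis]] .
  then show ?thesis by (simp add: grid_index_def)
qed

lemma grid_cell_eq:
  fixes w :: "'a::euclidean_space"
  assumes "w \<in> grid_cell h j"
  shows "grid_cell h j = {w'. \<forall>b\<in>Basis. \<lfloor>w' \<bullet> b / h\<rfloor> = \<lfloor>w \<bullet> b / h\<rfloor>}"
  using assms by (auto simp: grid_cell_def grid_index_eq_iff[symmetric])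

lemma grid_cell_measurable [measurable]: "grid_cell h j \<in> sets (borel :: 'a::euclidean_space measure)"
proof (cases "grid_cell h j = ({} :: 'a set)")
  case False
  then obtain w :: 'a where "w \<in> grid_cell h j" by blast
  show ?thesis unfolding grid_cell_eq[OF \<open>w \<in> grid_cell h j\<close>]
    by measurable
qed simp

lemma disjoint_grid_cell: "disjoint_family (grid_cell h)"
  by (auto simp: disjoint_family_on_def grid_cell_def)

lemma Union_grid_cell: "(\<Union>j. grid_cell h j) = UNIV"
  by (auto simp: grid_cell_def)

lemma dist_grid_cell:
  fixes w w' :: "'a::euclidean_space"
  assumes h: "0 < h" and "w \<in> grid_cell h j" "w' \<in> grid_cell h j"
  shows "dist w w' \<le> real DIM('a) * h"
proof -
  have "\<bar>(w - w') \<bullet> b\<bar> \<le> h" if "b \<in> Basis" for b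
  proof -
    have "\<lfloor>w' \<bullet> b / h\<rfloor> = \<lfloor>w \<bullet> b / h\<rfloor>" using assms(3) that unfolding grid_cell_eq[OF assms(2)] by simp
    then have "\<bar>w \<bullet> b / h - w' \<bullet> b / h\<bar> \<le> 1" by linarith
    then have "\<bar>((w - w') \<bullet> b) / h\<bar> \<le> 1" by (simp add: inner_diff_left diff_divide_distrib)
    then show ?thesis using h by (simp add: abs_divide)
  qed
  then have "(\<Sum>b\<in>Basis. \<bar>(w - w') \<bullet> b\<bar>) \<le> (\<Sum>b\<in>(Basis::'a set). h)" by (intro sum_mono)
  then show ?thesis using norm_le_l1[of "w - w'"] by (simp add: dist_norm)
qed

lemma measure_grid_cell:
  fixes w :: "'a::euclidean_space"
  assumes h: "0 < h" and w: "w \<in> grid_cell h j"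
  shows "measure lborel (grid_cell h j :: 'a set) = h ^ DIM('a)"
proof -
  define a :: 'a where "a = (\<Sum>b\<in>Basis. (h * \<lfloor>w \<bullet> b / h\<rfloor>) *\<^sub>R b)"
  define c :: 'a where "c = (\<Sum>b\<in>Basis. (h * (\<lfloor>w \<bullet> b / h\<rfloor> + 1)) *\<^sub>R b)"
  have ac: "a \<bullet> b = h * \<lfloor>w \<bullet> b / h\<rfloor>" "c \<bullet> b = h * (\<lfloor>w \<bullet> b / h\<rfloor> + 1)" if "b \<in> Basis" for b
    using that by (simp_all add: a_def c_def)
  have le: "a \<bullet> b \<le> c \<bullet> b" "(c - a) \<bullet> b = h" if "b \<in> Basis" for b
    using h by (simp_all add: ac[OF that] inner_diff_left algebra_simps)
  have fl: "\<lfloor>x / h\<rfloor> = i \<longleftrightarrow> h * of_int i \<le> x \<and> x < h * (of_int i + 1)" for x :: real and i :: int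
    using h by (auto simp: floor_eq_iff field_simps)
  have cell: "grid_cell h j = {w'. \<forall>b\<in>Basis. a \<bullet> b \<le> w' \<bullet> b \<and> w' \<bullet> b < c \<bullet> b}"
    unfolding grid_cell_eq[OF w] by (auto simp: ac fl)
  have box: "measure lborel (box a c) = h ^ DIM('a)" "measure lborel (cbox a c) = h ^ DIM('a)"
    using le by (simp_all add: measure_lborel_box_eq measure_lborel_cbox_eq)
  have cb: "grid_cell h j \<subseteq> cbox a c" "box a c \<subseteq> grid_cell h j"
    by (force simp: cell mem_box)+
  have "grid_cell h j \<in> fmeasurable (lborel :: 'a measure)"
    by (rule fmeasurableI2[OF fmeasurable_cbox cb(1)]) simp
  then have "measure lborel (box a c) \<le> measure lborel (grid_cell h j :: 'a set)"
    by (intro measure_mono_fmeasurable[OF cb(2)]) simp_all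
  moreover have "measure lborel (grid_cell h j :: 'a set) \<le> measure lborel (cbox a c)"
    by (rule measure_mono_fmeasurable[OF cb(1)]) simp_all
  ultimately show ?thesis using box by simp
qed

text \<open>
  The cells that meet \<open>A\<close> are disjoint, have volume \<open>h ^ d\<close>, and lie in a slightly larger ball.
\<close>

lemma card_grid_cells_meeting_ball:
  fixes A :: "'a::euclidean_space set"
  assumes h: "0 < h" and A: "A \<subseteq> cball z \<rho>" "0 \<le> \<rho>"
  defines "K \<equiv> {j. grid_cell h j \<inter> A \<noteq> {}}"
  shows "finite K" "real (card K) \<le> ball_volume TYPE('a) (\<rho> + real DIM('a) * h) / h ^ DIM('a)"
proof -
  let ?R = "\<rho> + real DIM('a) * h"
  have R: "0 \<le> ?R" using h A by simp
  have sub: "grid_cell h j \<subseteq> cball z ?R" if "j \<in> K" for j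
  proof
    fix w :: 'a assume w: "w \<in> grid_cell h j"
    obtain v where v: "v \<in> grid_cell h j" "v \<in> A" using \<open>j \<in> K\<close> unfolding K_def by blast
    have "dist z w \<le> dist z v + dist v w" by (rule dist_triangle)
    also have "\<dots> \<le> ?R" using dist_grid_cell[OF h v(1) w] v(2) A by (intro add_mono) auto
    finally show "w \<in> cball z ?R" by simp
  qed
  have bound: "real (card J) \<le> ball_volume TYPE('a) ?R / h ^ DIM('a)" if J: "J \<subseteq> K" "finite J" for J
  proof -
    have fm: "grid_cell h j \<in> fmeasurable (lborel :: 'a measure)" if "j \<in> J" for j
      using sub[of j] that J by (intro bounded_borel_fmeasurable[of _ z ?R]) auto
    have "real (card J) * h ^ DIM('a) = (\<Sum>j\<in>J. measure lborel (grid_cell h j :: 'a set))"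
    proof -
      have "measure lborel (grid_cell h j :: 'a set) = h ^ DIM('a)" if "j \<in> J" for j
        using that J measure_grid_cell[OF h] by (fastforce simp: K_def)
      then show ?thesis by simp
    qed
    also have "\<dots> = measure lborel (\<Union>j\<in>J. grid_cell h j :: 'a set)"
      using fm J disjoint_grid_cell
      by (intro measure_finite_Union[symmetric])
        (auto dest: fmeasurableD2 intro: disjoint_family_on_mono[OF subset_UNIV])
    also have "\<dots> \<le> measure lborel (cball z ?R)"
      using sub J by (intro measure_mono_fmeasurable bounded_borel_fmeasurable[of _ z ?R]) (auto intro: sets.finite_UN)
    finally show ?thesis using h R by (simp add: ball_volume_eq[OF R, of z] pos_le_divide_eq)
  qed
  show "finite K"
  proof (rule ccontr)
    assume "infinite K"
    obtain n :: nat where n: "ball_volume TYPE('a) ?R / h ^ DIM('a) < real n" using reals_Archimedean2 by blast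
    obtain J where "J \<subseteq> K" "finite J" "card J = n" using infinite_arbitrarily_large[OF \<open>infinite K\<close>] by blast
    with bound[of J] n show False by simp
  qed
  then show "real (card K) \<le> ball_volume TYPE('a) ?R / h ^ DIM('a)" by (intro bound) auto
qed

text \<open>
  Covering \<open>A\<close> by cells costs the error \<open>c\<close> once for every cell used, and \<open>B\<close> contains all these cells.
\<close>

lemma measure_le_of_grid_cells:
  fixes \<alpha> \<beta> :: "'a::euclidean_space measure"
  assumes \<alpha>: "finite_measure \<alpha>" "sets \<alpha> = sets borel" and \<beta>: "finite_measure \<beta>" "sets \<beta> = sets borel"
    and h: "0 < h" and close: "\<And>j. \<bar>measure \<alpha> (grid_cell h j) - measure \<beta> (grid_cell h j)\<bar> \<le> c"
    and A: "A \<subseteq> cball z \<rho>" "0 \<le> \<rho>" and [measurable]: "A \<in> sets borel" "B \<in> sets borel"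
    and AB: "\<And>a w. a \<in> A \<Longrightarrow> dist a w \<le> real DIM('a) * h \<Longrightarrow> w \<in> B"
  shows "measure \<alpha> A \<le> measure \<beta> B + c * (ball_volume TYPE('a) (\<rho> + real DIM('a) * h) / h ^ DIM('a))"
proof -
  interpret \<alpha>: finite_measure \<alpha> by fact
  interpret \<beta>: finite_measure \<beta> by fact
  define K where "K = {j. grid_cell h j \<inter> A \<noteq> {}}"
  note K = card_grid_cells_meeting_ball[OF h A, folded K_def]
  have c: "0 \<le> c" using close[of 0] by linarith
  have "A \<subseteq> (\<Union>j\<in>K. grid_cell h j)"
    by (auto simp: K_def grid_cell_def)
  then have "measure \<alpha> A \<le> measure \<alpha> (\<Union>j\<in>K. grid_cell h j)"
    using K by (intro \<alpha>.finite_measure_mono) (auto simp: \<alpha>(2) intro: sets.finite_UN)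
  also have "\<dots> \<le> (\<Sum>j\<in>K. measure \<alpha> (grid_cell h j))"
    using K by (intro \<alpha>.finite_measure_subadditive_finite) (auto simp: \<alpha>(2))
  also have "\<dots> \<le> (\<Sum>j\<in>K. measure \<beta> (grid_cell h j) + c)"
  proof (rule sum_mono)
    fix j show "measure \<alpha> (grid_cell h j) \<le> measure \<beta> (grid_cell h j) + c"
      using close[of j] by linarith
  qed
  also have "\<dots> = measure \<beta> (\<Union>j\<in>K. grid_cell h j) + real (card K) * c"
    using K disjoint_grid_cell
    by (subst \<beta>.finite_measure_finite_Union) (auto simp: \<beta>(2) sum.distrib disjoint_family_on_def)
  also have "\<dots> \<le> measure \<beta> B + c * (ball_volume TYPE('a) (\<rho> + real DIM('a) * h) / h ^ DIM('a))"
  proof (intro add_mono \<beta>.finite_measure_mono)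
    show "(\<Union>j\<in>K. grid_cell h j) \<subseteq> B"
      using AB dist_grid_cell[OF h] by (fastforce simp: K_def)
    show "B \<in> sets \<beta>" by (simp add: \<beta>(2))
    show "real (card K) * c \<le> c * (ball_volume TYPE('a) (\<rho> + real DIM('a) * h) / h ^ DIM('a))"
      using mult_left_mono[OF K(2) c] by (simp add: mult.commute)
  qed
  finally show ?thesis .
qed

section \<open>Uniformly continuous densities\<close>

locale uniformly_continuous_density =
  fixes f :: "'a::euclidean_space \<Rightarrow> real"
  assumes uniformly_continuous: "uniformly_continuous_on UNIV f"
    and nonneg: "0 \<le> f x"
    and has_integral_1: "has_bochner_integral lborel f 1"
begin

abbreviation law :: "'a measure" where
  "law \<equiv> density lborel (\<lambda>x. ennreal (f x))"

lemma borel_f [measurable]: "f \<in> borel_measurable borel"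
  using borel_measurable_has_bochner_integral[OF has_integral_1] by simp

lemma prob_space_law: "prob_space law"
proof (rule prob_spaceI)
  have "emeasure law (space law) = (\<integral>\<^sup>+x. ennreal (f x) \<partial>lborel)"
    by (simp add: emeasure_density)
  also have "\<dots> = ennreal 1"
    using has_integral_1 nonneg by (subst nn_integral_eq_integral) (auto simp: has_bochner_integral_iff)
  finally show "emeasure law (space law) = 1" by simp
qed

sublocale law: prob_space law by (rule prob_space_law)

lemma measure_law:
  assumes [measurable]: "A \<in> sets borel"
  shows "measure law A = (LINT z:A|lborel. f z)"
proof -
  have "measure law A = (\<integral>x. indicator A x \<partial>law)" by simp
  also have "\<dots> = (LINT z:A|lborel. f z)"
    using nonneg by (subst integral_density) (auto simp: set_lebesgue_integral_def mult.commute)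
  finally show ?thesis .
qed

lemma integrable_f: "integrable lborel f"
  using has_integral_1 by (simp add: has_bochner_integral_iff)

lemma set_integrable_f: "A \<in> sets borel \<Longrightarrow> set_integrable lborel A f"
  unfolding set_integrable_def using integrable_f by (intro integrable_mult_indicator) auto

lemma measure_law_le:
  assumes A: "A \<in> fmeasurable lborel" and le: "\<And>x. x \<in> A \<Longrightarrow> f x \<le> c"
  shows "measure law A \<le> c * measure lborel A"
proof -
  have Am[measurable]: "A \<in> sets borel" using fmeasurableD[OF A] by simp
  have "measure law A = (LINT z:A|lborel. f z)" by (rule measure_law) simp
  also have "\<dots> \<le> (LINT z:A|lborel. c)"
    using A le by (intro set_integral_mono set_integrable_f)
      (auto simp: set_integrable_def fmeasurable_def)
  also have "\<dots> = c * measure lborel A" by (simp add: set_lebesgue_integral_def mult.commute)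
  finally show ?thesis .
qed

lemma measure_law_ge:
  assumes A: "A \<in> fmeasurable lborel" and le: "\<And>x. x \<in> A \<Longrightarrow> c \<le> f x"
  shows "c * measure lborel A \<le> measure law A"
proof -
  have Am[measurable]: "A \<in> sets borel" using fmeasurableD[OF A] by simp
  have "c * measure lborel A = (LINT z:A|lborel. c)" by (simp add: set_lebesgue_integral_def mult.commute)
  also have "\<dots> \<le> (LINT z:A|lborel. f z)"
    using A le by (intro set_integral_mono set_integrable_f)
      (auto simp: set_integrable_def fmeasurable_def)
  also have "\<dots> = measure law A" by (rule measure_law[symmetric]) simp
  finally show ?thesis .
qed

lemma oscillation:
  assumes "0 < e"
  obtains \<rho> where "0 < \<rho>" "\<And>x y. dist x y < \<rho> \<Longrightarrow> \<bar>f x - f y\<bar> \<le> e"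
proof -
  obtain \<rho> where "0 < \<rho>" "\<And>x y. dist x y < \<rho> \<Longrightarrow> dist (f x) (f y) < e"
    using uniformly_continuous assms unfolding uniformly_continuous_on_def by (metis UNIV_I dist_commute)
  then show ?thesis by (intro that[of \<rho>]) (auto simp: dist_real_def less_imp_le)
qed

text \<open>
  On a ball of fixed radius around a point where \<open>f\<close> is large, \<open>f\<close> stays large, and the integral
  over that ball is at most one.
\<close>

lemma bounded_above: obtains F where "0 < F" "\<And>x. f x \<le> F"
proof -
  obtain \<rho> where \<rho>: "0 < \<rho>" "\<And>x y. dist x y < \<rho> \<Longrightarrow> \<bar>f x - f y\<bar> \<le> 1"
    using oscillation[of 1] by auto
  let ?V = "ball_volume TYPE('a) (\<rho> / 2)"
  have V: "0 < ?V" using \<rho> by (intro ball_volume_pos) simp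
  show ?thesis
  proof (rule that[of "1 + 1 / ?V"])
    fix z
    have "(f z - 1) * ?V \<le> measure law (cball z (\<rho> / 2))"
      unfolding ball_volume_eq[OF less_imp_le, of "\<rho>/2" z, OF half_gt_zero[OF \<rho>(1)]]
    proof (rule measure_law_ge)
      show "cball z (\<rho> / 2) \<in> fmeasurable lborel" by (rule bounded_borel_fmeasurable) auto
      fix x assume "x \<in> cball z (\<rho> / 2)"
      then have "dist z x < \<rho>" using \<rho>(1) by simp
      from \<rho>(2)[OF this] show "f z - 1 \<le> f x" by linarith
    qed
    also have "\<dots> \<le> 1" by simp
    finally show "f z \<le> 1 + 1 / ?V" using V by (simp add: field_simps)
  qed (use V in \<open>simp add: add_pos_pos\<close>)
qed

lemma caps_regular_law:
  assumes "0 < \<delta>"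
  obtains k r0 where "0 < k" "k \<le> 1" "0 < r0" "\<And>r. 0 < r \<Longrightarrow> r < r0 \<Longrightarrow> caps_regular f law r k \<delta>"
proof -
  obtain F where F: "0 < F" "\<And>x. f x \<le> F" using bounded_above by blast
  define \<theta> where "\<theta> = min 1 (\<delta> / F)"
  have \<theta>: "0 < \<theta>" "\<theta> \<le> 1" using assms F by (auto simp: \<theta>_def)
  have "\<theta> \<le> \<delta> / F" by (simp add: \<theta>_def)
  then have F\<theta>: "F * \<theta> \<le> \<delta>" using F by (simp add: field_simps)
  obtain k0 where k0: "0 < k0" "\<And>k r (z::'a) u. \<lbrakk>0 < k; k \<le> k0; 0 < r; norm u = 1\<rbrakk> \<Longrightarrow>
      measure lborel (cap z u r (- k)) \<le> ball_volume TYPE('a) r * ((1 + \<theta>) / 2) \<and>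
      ball_volume TYPE('a) r * ((1 - \<theta>) / 2) \<le> measure lborel (cap z u r k)"
    using cap_volume[OF \<theta>(1)] by metis
  have d2: "0 < \<delta> / 2" using assms by simp
  obtain \<rho> where \<rho>: "0 < \<rho>" "\<And>x y. dist x y < \<rho> \<Longrightarrow> \<bar>f x - f y\<bar> \<le> \<delta> / 2"
    using oscillation[OF d2] by blast
  define k where "k = min k0 1"
  have k: "0 < k" "k \<le> k0" using k0 by (auto simp: k_def)
  have "caps_regular f law r k \<delta>" if r: "0 < r" "r < \<rho>" for r
    unfolding caps_regular_def
  proof (intro allI impI conjI)
    fix z u :: 'a assume u: "norm u = 1"
    let ?V = "ball_volume TYPE('a) r"
    have V: "0 < ?V" using r by (intro ball_volume_pos)
    have osc: "\<bar>f z - f x\<bar> \<le> \<delta> / 2" if "x \<in> cap z u r j" for x j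
      using that r by (intro \<rho>(2)) (auto simp: cap_def)
    note vol = k0(2)[OF k r(1) u, of z]
    have "measure law (cap z u r (- k)) \<le> (f z + \<delta> / 2) * measure lborel (cap z u r (- k))"
      using osc by (intro measure_law_le cap_fmeasurable) (smt (verit))
    also have "\<dots> \<le> (f z + \<delta> / 2) * (?V * ((1 + \<theta>) / 2))"
      using vol nonneg[of z] assms by (intro mult_left_mono) auto
    also have "\<dots> = ?V * ((f z + \<delta> / 2) * ((1 + \<theta>) / 2))" by simp
    also have "\<dots> \<le> ?V * (f z / 2 + \<delta>)"
    proof (rule mult_left_mono)
      have "f z * \<theta> \<le> \<delta>" using mult_right_mono[OF F(2)[of z], of \<theta>] \<theta> F\<theta> by linarith
      moreover have "\<delta> * \<theta> \<le> \<delta>" using \<theta> assms by simp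
      ultimately show "(f z + \<delta> / 2) * ((1 + \<theta>) / 2) \<le> f z / 2 + \<delta>"
        by (simp add: field_simps)
    qed (use V in simp)
    finally show "measure law (cap z u r (- k)) \<le> ?V * (f z / 2 + \<delta>)" .
    show "?V * (f z / 2 - \<delta>) \<le> measure law (cap z u r k)"
    proof (cases "f z \<le> \<delta> / 2")
      case True
      then have "f z / 2 - \<delta> \<le> 0" using nonneg[of z] assms by linarith
      then have "?V * (f z / 2 - \<delta>) \<le> 0" using V by (simp add: mult_le_0_iff)
      also have "0 \<le> measure law (cap z u r k)" by simp
      finally show ?thesis .
    next
      case False
      have "?V * (f z / 2 - \<delta>) \<le> ?V * ((f z - \<delta> / 2) * ((1 - \<theta>) / 2))"
      proof (rule mult_left_mono)
        have "f z * \<theta> \<le> \<delta>" using mult_right_mono[OF F(2)[of z], of \<theta>] \<theta> F\<theta> by linarith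
        moreover have "0 \<le> \<delta> * \<theta>" using \<theta> assms by simp
        ultimately show "f z / 2 - \<delta> \<le> (f z - \<delta> / 2) * ((1 - \<theta>) / 2)"
          using assms by (simp add: field_simps)
      qed (use V in simp)
      also have "\<dots> = (f z - \<delta> / 2) * (?V * ((1 - \<theta>) / 2))" by simp
      also have "\<dots> \<le> (f z - \<delta> / 2) * measure lborel (cap z u r k)"
        using vol False by (intro mult_left_mono) auto
      also have "\<dots> \<le> measure law (cap z u r k)"
        using osc by (intro measure_law_ge cap_fmeasurable) (smt (verit))
      finally show ?thesis .
    qed
  qed
  with k \<rho> show ?thesis by (intro that[of k \<rho>]) (auto simp: k_def)
qed

text \<open>
  A measure whose cell masses agree with those of the law up to \<open>\<eta> * r ^ d\<close> inherits cap regularity: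
  a cap is covered by boundedly many cells of side \<open>g * r\<close>, and these lie in a cap of slightly
  larger radius with a slightly lower bounding hyperplane. The lower bound works
  the other way round, starting from a slightly smaller cap.
\<close>

lemma caps_regular_of_grid_cells:
  assumes \<delta>: "0 < \<delta>"
  obtains k g \<eta> r0 where "0 < k" "k \<le> 1" "0 < g" "0 < \<eta>" "0 < r0"
    "\<And>r \<nu>. \<lbrakk>0 < r; r < r0; finite_measure \<nu>; sets \<nu> = sets borel;
       \<And>j. \<bar>measure \<nu> (grid_cell (g * r) j) - measure law (grid_cell (g * r) j)\<bar> \<le> \<eta> * r ^ DIM('a)\<rbrakk>
      \<Longrightarrow> caps_regular f \<nu> r k \<delta>"
proof -
  let ?d = "DIM('a)" let ?V = "ball_volume TYPE('a)"
  obtain F where F: "0 < F" "\<And>x. f x \<le> F" using bounded_above by blast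
  have d4: "0 < \<delta> / 4" using \<delta> by simp
  obtain k0 r0 where k0: "0 < k0" "k0 \<le> 1" "0 < r0"
    and reg: "\<And>r. 0 < r \<Longrightarrow> r < r0 \<Longrightarrow> caps_regular f law r k0 (\<delta> / 4)"
    using caps_regular_law[OF d4] by metis
  \<comment> \<open>The relative volume change \<open>\<theta>\<close> from adjusting the radius costs at most \<open>\<theta> * (F + \<delta>) = \<delta> / 4\<close>.\<close>
  define \<theta> where "\<theta> = \<delta> / (4 * (F + \<delta>))"
  have \<theta>: "0 < \<theta>" "\<theta> * (F + \<delta>) = \<delta> / 4" using \<delta> F by (auto simp: \<theta>_def field_simps)
  have lim: "((\<lambda>a::real. (1 + a) ^ ?d) \<longlongrightarrow> (1 + 0) ^ ?d) (at_right 0)"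
    "((\<lambda>a::real. (1 - a) ^ ?d) \<longlongrightarrow> (1 - 0) ^ ?d) (at_right 0)"
    by (intro tendsto_intros)+
  have "\<forall>\<^sub>F a in at_right (0::real). (1 + a) ^ ?d < 1 + \<theta>"
    by (rule order_tendstoD(2)[OF lim(1)]) (use \<theta> in simp)
  moreover have "\<forall>\<^sub>F a in at_right (0::real). 1 - \<theta> < (1 - a) ^ ?d"
    by (rule order_tendstoD(1)[OF lim(2)]) (use \<theta> in simp)
  moreover have "\<forall>\<^sub>F a in at_right (0::real). a < min (1/2) (k0 / 4)"
    using k0 by (intro order_tendstoD(2)[OF tendsto_ident_at]) auto
  moreover have "\<forall>\<^sub>F a in at_right (0::real). 0 < a" by (rule eventually_at_right_less)
  ultimately have "\<forall>\<^sub>F a in at_right (0::real). (1 + a) ^ ?d < 1 + \<theta> \<and> 1 - \<theta> < (1 - a) ^ ?d \<and> a < min (1/2) (k0/4) \<and> 0 < a"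
    by eventually_elim simp
  then obtain a where a: "(1 + a) ^ ?d < 1 + \<theta>" "1 - \<theta> < (1 - a) ^ ?d" "a < 1/2" "a < k0 / 4" "0 < a"
    using eventually_happens'[OF trivial_limit_at_right_real] by auto
  define g where "g = a / real ?d"
  have g: "0 < g" "real ?d * g = a" using a by (auto simp: g_def)
  \<comment> \<open>With this \<open>\<eta>\<close> the errors of all cells that meet a ball of radius \<open>r\<close> add up to \<open>\<delta> / 4\<close> times its volume.\<close>
  define \<eta> where "\<eta> = \<delta> / 4 * (g ^ ?d / (1 + a) ^ ?d)"
  have \<eta>: "0 < \<eta>" using \<delta> g a by (simp add: \<eta>_def)
  show ?thesis
  proof (rule that[of "k0 / 4" g \<eta> "r0 / 2"])
    fix r and \<nu> :: "'a measure"
    assume r: "0 < r" "r < r0 / 2" and \<nu>: "finite_measure \<nu>" "sets \<nu> = sets borel"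
      and close: "\<And>j. \<bar>measure \<nu> (grid_cell (g * r) j) - measure law (grid_cell (g * r) j)\<bar> \<le> \<eta> * r ^ ?d"
    have close': "\<bar>measure law (grid_cell (g * r) j) - measure \<nu> (grid_cell (g * r) j)\<bar> \<le> \<eta> * r ^ ?d" for j
      using close[of j] by (simp add: abs_minus_commute)
    have gr: "0 < g * r" "real ?d * (g * r) = a * r" using g r by (auto simp: mult.assoc[symmetric])
    have V: "0 < ?V r" using r by (intro ball_volume_pos)
    have err: "\<eta> * r ^ ?d * (?V (r + a * r) / (g * r) ^ ?d) = \<delta> / 4 * ?V r"
    proof -
      have "?V (r + a * r) = (1 + a) ^ ?d * ?V r"
        using ball_volume_mult[where 'a = 'a, of "1 + a" r] by (simp add: distrib_right)
      then show ?thesis using g r a by (simp add: \<eta>_def power_mult_distrib)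
    qed
    have big: "0 < (1 + a) * r" "(1 + a) * r < r0"
    proof -
      have "(1 + a) * r \<le> 2 * r" using a r by (intro mult_right_mono) auto
      then show "(1 + a) * r < r0" using r by linarith
    qed (use a r in simp)
    show "caps_regular f \<nu> r (k0 / 4) \<delta>"
      unfolding caps_regular_def
    proof (intro allI impI conjI)
      fix z u :: 'a assume u: "norm u = 1"
      have inner_le: "\<bar>(w - v) \<bullet> u\<bar> \<le> dist v w" for v w
        using Cauchy_Schwarz_ineq2[of "w - v" u] u by (simp add: dist_norm norm_minus_commute)
      have incl: "w \<in> cap z u \<rho>' j'"
        if v: "v \<in> cap z u \<rho> j" and vw: "dist v w \<le> a * r" and *: "\<rho> + a * r \<le> \<rho>'" "j' * \<rho>' \<le> j * \<rho> - a * r"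
        for v w \<rho> \<rho>' j j'
      proof -
        have "dist z w \<le> dist z v + dist v w" by (rule dist_triangle)
        moreover have "(w - z) \<bullet> u = (v - z) \<bullet> u + (w - v) \<bullet> u" by (simp add: inner_diff_left)
        ultimately show ?thesis using v vw * inner_le[of w v] by (auto simp: cap_def)
      qed
      have "measure \<nu> (cap z u r (- (k0 / 4))) \<le> measure law (cap z u ((1 + a) * r) (- k0))
          + \<eta> * r ^ ?d * (?V (r + real ?d * (g * r)) / (g * r) ^ ?d)"
      proof (rule measure_le_of_grid_cells[OF \<nu> law.finite_measure_axioms _ gr(1) close])
        fix v w assume v: "v \<in> cap z u r (- (k0 / 4))" and vw: "dist v w \<le> real ?d * (g * r)"
        show "w \<in> cap z u ((1 + a) * r) (- k0)"
        proof (rule incl[OF v vw[unfolded gr(2)]])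
          have "a * r \<le> k0 / 4 * r" using a r by (intro mult_right_mono) auto
          moreover have "k0 * r \<le> k0 * ((1 + a) * r)" using a r k0 by (intro mult_left_mono) auto
          moreover have "0 < k0 * r" using k0 r by simp
          ultimately show "- k0 * ((1 + a) * r) \<le> - (k0 / 4) * r - a * r" by simp
        qed (simp add: algebra_simps)
      qed (use r in \<open>auto simp: cap_def intro: cap_measurable\<close>)
      also have "\<dots> \<le> ?V ((1 + a) * r) * (f z / 2 + \<delta> / 4) + \<delta> / 4 * ?V r"
        unfolding gr(2) err by (intro add_mono caps_regularD(1)[OF reg u] big order_refl)
      also have "\<dots> \<le> ((1 + \<theta>) * ?V r) * (f z / 2 + \<delta> / 4) + \<delta> / 4 * ?V r"
        unfolding ball_volume_mult using a V nonneg[of z] \<delta>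
        by (intro add_mono mult_right_mono) auto
      also have "\<dots> = ?V r * (f z / 2 + \<delta> / 2 + (\<theta> * (f z / 2 + \<delta> / 4)))" by (simp add: algebra_simps)
      also have "\<dots> \<le> ?V r * (f z / 2 + \<delta>)"
      proof (rule mult_left_mono)
        have "\<theta> * (f z / 2 + \<delta> / 4) \<le> \<theta> * (F + \<delta>)"
          using F(2)[of z] F(1) \<delta> \<theta> nonneg[of z] by (intro mult_left_mono) auto
        then show "f z / 2 + \<delta> / 2 + (\<theta> * (f z / 2 + \<delta> / 4)) \<le> f z / 2 + \<delta>" using \<theta> \<delta> by linarith
      qed (use V in simp)
      finally show "measure \<nu> (cap z u r (- (k0 / 4))) \<le> ?V r * (f z / 2 + \<delta>)" .

      show "?V r * (f z / 2 - \<delta>) \<le> measure \<nu> (cap z u r (k0 / 4))"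
      proof (cases "f z / 2 \<le> \<delta> / 4")
        case True
        then have "?V r * (f z / 2 - \<delta>) \<le> 0" using V \<delta> by (simp add: mult_le_0_iff)
        also have "0 \<le> measure \<nu> (cap z u r (k0 / 4))" by simp
        finally show ?thesis .
      next
        case False
        have "?V ((1 - a) * r) * (f z / 2 - \<delta> / 4) \<le> measure law (cap z u ((1 - a) * r) k0)"
        proof (intro caps_regularD(2)[OF reg u])
          show "0 < (1 - a) * r" using a r by simp
          have "(1 - a) * r \<le> 1 * r" using a r by (intro mult_right_mono) auto
          then show "(1 - a) * r < r0" using r by linarith
        qed
        also have "\<dots> \<le> measure \<nu> (cap z u r (k0 / 4))
            + \<eta> * r ^ ?d * (?V (r + real ?d * (g * r)) / (g * r) ^ ?d)"
        proof (rule measure_le_of_grid_cells[OF law.finite_measure_axioms _ \<nu> gr(1) close'])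
          fix v w assume v: "v \<in> cap z u ((1 - a) * r) k0" and vw: "dist v w \<le> real ?d * (g * r)"
          show "w \<in> cap z u r (k0 / 4)"
          proof (rule incl[OF v vw[unfolded gr(2)]])
            have "a * r \<le> k0 / 4 * r" using a r by (intro mult_right_mono) auto
            moreover have "k0 * (1/2 * r) \<le> k0 * ((1 - a) * r)"
              using a r k0 by (intro mult_left_mono mult_right_mono) auto
            ultimately show "k0 / 4 * r \<le> k0 * ((1 - a) * r) - a * r" by simp
          qed (simp add: algebra_simps)
        next
          have "(1 - a) * r \<le> 1 * r" using a r by (intro mult_right_mono) auto
          then show "cap z u ((1 - a) * r) k0 \<subseteq> cball z r" by (auto simp: cap_def)
        qed (use r in \<open>auto intro: cap_measurable\<close>)
        also have "\<dots> = measure \<nu> (cap z u r (k0 / 4)) + \<delta> / 4 * ?V r" unfolding gr(2) err ..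
        finally have 1: "?V ((1 - a) * r) * (f z / 2 - \<delta> / 4) - \<delta> / 4 * ?V r \<le> measure \<nu> (cap z u r (k0 / 4))"
          by simp
        have "((1 - \<theta>) * ?V r) * (f z / 2 - \<delta> / 4) \<le> ?V ((1 - a) * r) * (f z / 2 - \<delta> / 4)"
          unfolding ball_volume_mult using a V False by (intro mult_right_mono) auto
        moreover have "?V r * (f z / 2 - \<delta>) \<le> ((1 - \<theta>) * ?V r) * (f z / 2 - \<delta> / 4) - \<delta> / 4 * ?V r"
        proof -
          have "\<theta> * (f z / 2 - \<delta> / 4) \<le> \<theta> * (F + \<delta>)"
            using F(2)[of z] F(1) \<delta> \<theta> nonneg[of z] by (intro mult_left_mono) auto
          moreover have "(1 - \<theta>) * (f z / 2 - \<delta> / 4) = (f z / 2 - \<delta> / 4) - \<theta> * (f z / 2 - \<delta> / 4)"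
            by (simp add: left_diff_distrib)
          ultimately have "f z / 2 - \<delta> \<le> (1 - \<theta>) * (f z / 2 - \<delta> / 4) - \<delta> / 4"
            using \<theta> \<delta> by linarith
          then have "?V r * (f z / 2 - \<delta>) \<le> ?V r * ((1 - \<theta>) * (f z / 2 - \<delta> / 4) - \<delta> / 4)"
            using V by (intro mult_left_mono) auto
          moreover have "v * (p * y - q) = (p * v) * y - q * v" for v p y q :: real
            by (simp add: algebra_simps)
          ultimately show ?thesis by simp
        qed
        ultimately show ?thesis using 1 by linarith
      qed
    qed
  qed (use k0 g \<eta> in auto)
qed

end

section \<open>Continuum coreness and good sets\<close>

context uniformly_continuous_density
begin

lemma ball_average_eq:
  "0 < r \<Longrightarrow> ball_average r f x = measure law (cball x r) / ball_volume TYPE('a) r"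
  by (simp add: ball_average_def measure_law)

text \<open>
  In terms of \<open>level\<close>, the condition on \<open>t\<close> in \<open>H_op\<close> is \<open>t * \<omega> * r ^ d \<le> level r \<phi> x t\<close>.
\<close>

definition level :: "real \<Rightarrow> ('a \<Rightarrow> real) \<Rightarrow> 'a \<Rightarrow> real \<Rightarrow> real" where
  "level r \<phi> x t = measure law (cball x r \<inter> {z. t \<le> \<phi> z})"

lemma H_op_eq:
  assumes [measurable]: "\<phi> \<in> borel_measurable borel" and r: "0 < r"
  shows "H_op r f \<phi> x = Sup {t. 0 \<le> t \<and> t * ball_volume TYPE('a) r \<le> level r \<phi> x t}"
proof -
  have V: "0 < ball_volume TYPE('a) r" using r by (rule ball_volume_pos)
  have "(LINT z:cball x r|lborel. indicat_real {z. t \<le> \<phi> z} z * f z) = level r \<phi> x t" for t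
    unfolding level_def
    by (subst measure_law) (auto simp: set_lebesgue_integral_def indicator_inter_arith mult.assoc)
  then show ?thesis using V by (simp add: H_op_def pos_le_divide_eq)
qed

lemma level_antimono:
  assumes [measurable]: "\<phi> \<in> borel_measurable borel" and "s \<le> t"
  shows "level r \<phi> x t \<le> level r \<phi> x s"
  unfolding level_def using assms(2) by (intro law.finite_measure_mono) auto

text \<open>
  The supremum is attained, because \<open>t \<mapsto> level r \<phi> x t\<close> is continuous from the left.
\<close>

lemma le_H_op_iff:
  assumes \<phi>[measurable]: "\<phi> \<in> borel_measurable borel" and r: "0 < r" and t: "0 \<le> t"
  shows "t \<le> H_op r f \<phi> x \<longleftrightarrow> t * ball_volume TYPE('a) r \<le> level r \<phi> x t"
proof
  let ?V = "ball_volume TYPE('a) r"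
  let ?T = "{t. 0 \<le> t \<and> t * ?V \<le> level r \<phi> x t}"
  have V: "0 < ?V" using r by (rule ball_volume_pos)
  have bdd: "bdd_above ?T"
  proof (rule bdd_aboveI)
    fix s assume "s \<in> ?T"
    then have "s * ?V \<le> level r \<phi> x s" by simp
    also have "\<dots> \<le> 1" by (simp add: level_def)
    finally show "s \<le> 1 / ?V" using V by (simp add: pos_le_divide_eq)
  qed
  {
    assume "t * ?V \<le> level r \<phi> x t"
    then show "t \<le> H_op r f \<phi> x" unfolding H_op_eq[OF \<phi> r] using t by (intro cSup_upper bdd) simp
  }
  assume le: "t \<le> H_op r f \<phi> x"
  have below: "s * ?V \<le> level r \<phi> x s" if s: "0 \<le> s" "s < t" for s
  proof -
    have "0 \<in> ?T" by (simp add: level_def)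
    then have "?T \<noteq> {}" by blast
    moreover have "s < Sup ?T" using le s unfolding H_op_eq[OF \<phi> r] by simp
    ultimately obtain s' where s': "s' \<in> ?T" "s < s'" using less_cSup_iff[OF _ bdd] by blast
    have "s * ?V \<le> s' * ?V" using s' V by simp
    also have "\<dots> \<le> level r \<phi> x s'" using s' by simp
    also have "\<dots> \<le> level r \<phi> x s" using s' by (intro level_antimono[OF \<phi>]) simp
    finally show ?thesis .
  qed
  show "t * ?V \<le> level r \<phi> x t"
  proof (cases "t = 0")
    case False
    with t have t0: "0 < t" by simp
    define s where "s n = t - t / real (Suc n)" for n
    have s: "0 \<le> s n" "s n < t" for n using t0 by (auto simp: s_def field_simps)
    have s_lim: "s \<longlonglongrightarrow> t"
    proof -
      have "(\<lambda>n. t - t * inverse (real (Suc n))) \<longlonglongrightarrow> t - t * 0"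
        by (intro tendsto_intros LIMSEQ_inverse_real_of_nat)
      then show ?thesis by (simp add: s_def[abs_def] divide_inverse)
    qed
    have "decseq (\<lambda>n. cball x r \<inter> {z. s n \<le> \<phi> z})"
    proof (rule decseq_SucI, rule subsetI)
      fix n z assume z: "z \<in> cball x r \<inter> {z. s (Suc n) \<le> \<phi> z}"
      have "s n \<le> s (Suc n)" using t0 unfolding s_def by (intro diff_left_mono divide_left_mono) auto
      with z show "z \<in> cball x r \<inter> {z. s n \<le> \<phi> z}" by auto
    qed
    then have "(\<lambda>n. level r \<phi> x (s n)) \<longlonglongrightarrow> measure law (\<Inter>n. cball x r \<inter> {z. s n \<le> \<phi> z})"
      unfolding level_def by (intro law.finite_Lim_measure_decseq) auto
    also have "(\<Inter>n. cball x r \<inter> {z. s n \<le> \<phi> z}) = cball x r \<inter> {z. t \<le> \<phi> z}"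
      using s(2) by (auto intro: LIMSEQ_le_const2[OF s_lim] order_trans[OF less_imp_le])
    finally have "(\<lambda>n. level r \<phi> x (s n)) \<longlonglongrightarrow> level r \<phi> x t" by (simp add: level_def)
    moreover have "(\<lambda>n. s n * ?V) \<longlonglongrightarrow> t * ?V" by (intro tendsto_intros s_lim)
    ultimately show ?thesis using below s by (intro LIMSEQ_le) auto
  qed (simp add: level_def)
qed

lemma H_op_nonneg:
  assumes "\<phi> \<in> borel_measurable borel" "0 < r"
  shows "0 \<le> H_op r f \<phi> x"
  using le_H_op_iff[OF assms, of 0 x] by (simp add: level_def)

lemma measure_cball_Int_measurable:
  assumes [measurable]: "A \<in> sets borel"
  shows "(\<lambda>x. measure law (cball x r \<inter> A)) \<in> borel_measurable borel"
proof -
  define Q where "Q = {p \<in> space (borel \<Otimes>\<^sub>M (borel :: 'a measure)). dist (fst p) (snd p) \<le> r \<and> snd p \<in> A}"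
  have "Q \<in> sets ((borel :: 'a measure) \<Otimes>\<^sub>M law)" unfolding Q_def by measurable
  then have *: "(\<lambda>x. emeasure law (Pair x -` Q)) \<in> borel_measurable borel"
    by (rule law.measurable_emeasure_Pair)
  have Q: "Pair x -` Q = cball x r \<inter> A" for x
    by (auto simp: Q_def space_pair_measure)
  show ?thesis using * unfolding measure_def Q by measurable
qed

lemma H_op_measurable [measurable (raw)]:
  assumes [measurable]: "\<phi> \<in> borel_measurable borel" and r: "0 < r"
  shows "H_op r f \<phi> \<in> borel_measurable borel"
proof (rule borel_measurable_iff_ge[THEN iffD2, rule_format])
  fix t :: real
  show "{w \<in> space borel. t \<le> H_op r f \<phi> w} \<in> sets borel"
  proof (cases "0 \<le> t")
    case True
    have [measurable]: "(\<lambda>x. level r \<phi> x t) \<in> borel_measurable borel"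
      unfolding level_def by (rule measure_cball_Int_measurable) simp
    have "{w \<in> space borel. t \<le> H_op r f \<phi> w} = {w \<in> space borel. t * ball_volume TYPE('a) r \<le> level r \<phi> w t}"
      using le_H_op_iff[OF assms True] by simp
    also have "\<dots> \<in> sets borel" by measurable
    finally show ?thesis .
  next
    case False
    then have "{w \<in> space borel. t \<le> H_op r f \<phi> w} = space borel"
      using H_op_nonneg[OF assms] by (auto intro: order_trans[of t 0])
    then show ?thesis by simp
  qed
qed

lemma H_op_mono:
  assumes \<phi>: "\<phi> \<in> borel_measurable borel" and [measurable]: "\<psi> \<in> borel_measurable borel"
    and r: "0 < r" and le: "\<And>z. \<phi> z \<le> \<psi> z"
  shows "H_op r f \<phi> x \<le> H_op r f \<psi> x"
proof -
  let ?t = "H_op r f \<phi> x"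
  have t: "0 \<le> ?t" by (rule H_op_nonneg[OF \<phi> r])
  have "?t * ball_volume TYPE('a) r \<le> level r \<phi> x ?t"
    using le_H_op_iff[OF \<phi> r t] by blast
  also have "\<dots> \<le> level r \<psi> x ?t"
    unfolding level_def using le by (intro law.finite_measure_mono) (auto intro: order_trans)
  finally show ?thesis using le_H_op_iff[OF assms(2) r t] by blast
qed

context
  fixes r :: real assumes r: "0 < r"
begin

definition iterate :: "nat \<Rightarrow> 'a \<Rightarrow> real" where
  "iterate k = (H_op r f ^^ k) (ball_average r f)"

lemma iterate_0: "iterate 0 = ball_average r f"
  and iterate_Suc: "iterate (Suc k) = H_op r f (iterate k)"
  by (simp_all add: iterate_def)

lemma iterate_measurable [measurable]: "iterate k \<in> borel_measurable borel"
proof (induction k)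
  case 0
  have [measurable]: "(\<lambda>x. measure law (cball x r)) \<in> borel_measurable borel"
    using measure_cball_Int_measurable[of UNIV] by simp
  show ?case unfolding iterate_0 ball_average_eq[OF r, abs_def] by measurable
next
  case (Suc k)
  then show ?case unfolding iterate_Suc by (rule H_op_measurable[OF _ r])
qed

lemma iterate_nonneg: "0 \<le> iterate k x"
  using H_op_nonneg[OF iterate_measurable r] ball_volume_pos[OF r, where 'a = 'a]
  by (cases k) (simp_all add: iterate_Suc iterate_0 ball_average_eq[OF r])

lemma iterate_Suc_le: "iterate (Suc k) x \<le> iterate k x"
proof (induction k arbitrary: x)
  case 0
  let ?t = "iterate (Suc 0) x"
  have "?t \<le> H_op r f (iterate 0) x" by (simp only: iterate_Suc)
  then have "?t * ball_volume TYPE('a) r \<le> level r (iterate 0) x ?t"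
    using le_H_op_iff[OF iterate_measurable r iterate_nonneg] by blast
  also have "\<dots> \<le> measure law (cball x r)"
    unfolding level_def by (intro law.finite_measure_mono) auto
  finally show ?case using ball_volume_pos[OF r, where 'a = 'a]
    by (simp add: iterate_0 ball_average_eq[OF r] pos_le_divide_eq)
next
  case (Suc k)
  have "H_op r f (iterate (Suc k)) x \<le> H_op r f (iterate k) x"
    by (intro H_op_mono iterate_measurable r Suc.IH)
  then show ?case by (simp only: iterate_Suc)
qed

lemma decseq_iterate: "decseq (\<lambda>k. iterate k x)"
  by (intro decseq_SucI iterate_Suc_le)

lemma iterate_tendsto: "(\<lambda>k. iterate k x) \<longlonglongrightarrow> continuum_r_coreness r f x"
proof -
  have nn: "\<forall>k. 0 \<le> iterate k x" by (simp add: iterate_nonneg)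
  obtain L where "(\<lambda>k. iterate k x) \<longlonglongrightarrow> L" "\<forall>k. L \<le> iterate k x"
    by (rule decseq_convergent[OF decseq_iterate nn])
  then have "convergent (\<lambda>k. iterate k x)" by (intro convergentI)
  then show ?thesis by (simp add: convergent_LIMSEQ_iff continuum_r_coreness_def iterate_def)
qed

lemma le_continuum_r_coreness_iff: "t \<le> continuum_r_coreness r f x \<longleftrightarrow> (\<forall>k. t \<le> iterate k x)"
proof (intro iffI allI)
  fix k assume "t \<le> continuum_r_coreness r f x"
  also have "\<dots> \<le> iterate k x" by (rule decseq_ge[OF decseq_iterate iterate_tendsto])
  finally show "t \<le> iterate k x" .
next
  assume "\<forall>k. t \<le> iterate k x"
  then show "t \<le> continuum_r_coreness r f x" by (intro LIMSEQ_le_const[OF iterate_tendsto]) auto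
qed

lemma continuum_r_coreness_nonneg: "0 \<le> continuum_r_coreness r f x"
  by (simp add: le_continuum_r_coreness_iff iterate_nonneg)

text \<open>
  A superlevel set of the limit is good: the densities of the superlevel sets of the iterates pass
  to the limit, because these sets decrease. Conversely, a good set stays inside the superlevel set
  of every iterate.
\<close>

lemma le_continuum_r_coreness_iff_good_at:
  assumes t: "0 \<le> t"
  shows "t \<le> continuum_r_coreness r f x \<longleftrightarrow> good_at law r t x"
proof
  let ?V = "ball_volume TYPE('a) r"
  assume x: "t \<le> continuum_r_coreness r f x"
  define S where "S = {z. \<forall>k. t \<le> iterate k z}"
  have [measurable]: "S \<in> sets borel" unfolding S_def by measurable
  show "good_at law r t x"
    unfolding good_at_def
  proof (intro bexI[of _ S] conjI ballI)
    show "x \<in> S" using x by (simp add: S_def le_continuum_r_coreness_iff)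
    fix z assume "z \<in> S"
    then have "t \<le> H_op r f (iterate k) z" for k by (auto simp: S_def iterate_Suc[symmetric])
    then have 1: "t * ?V \<le> level r (iterate k) z t" for k
      using le_H_op_iff[OF iterate_measurable r t] by blast
    have "decseq (\<lambda>k. cball z r \<inter> {w. t \<le> iterate k w})"
      by (intro decseq_SucI) (auto intro: order_trans[OF _ iterate_Suc_le])
    then have "(\<lambda>k. level r (iterate k) z t) \<longlonglongrightarrow> measure law (\<Inter>k. cball z r \<inter> {w. t \<le> iterate k w})"
      unfolding level_def by (intro law.finite_Lim_measure_decseq) auto
    also have "(\<Inter>k. cball z r \<inter> {w. t \<le> iterate k w}) = cball z r \<inter> S" by (auto simp: S_def)
    finally show "t * ?V \<le> measure law (cball z r \<inter> S)"
      by (rule LIMSEQ_le_const) (use 1 in auto)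
  qed simp
next
  let ?V = "ball_volume TYPE('a) r"
  have V: "0 < ?V" using r by (rule ball_volume_pos)
  assume "good_at law r t x"
  then obtain S where [measurable]: "S \<in> sets borel" and x: "x \<in> S"
    and dens: "\<And>z. z \<in> S \<Longrightarrow> t * ?V \<le> measure law (cball z r \<inter> S)" by (auto simp: good_at_def)
  have "t \<le> iterate k z" if "z \<in> S" for k z
    using that
  proof (induction k arbitrary: z)
    case 0
    have "t * ?V \<le> measure law (cball z r)"
      using dens[OF 0] by (rule order_trans) (intro law.finite_measure_mono, auto)
    then show ?case using V by (simp add: iterate_0 ball_average_eq[OF r] pos_le_divide_eq)
  next
    case (Suc k)
    have "measure law (cball z r \<inter> S) \<le> level r (iterate k) z t"
      unfolding level_def using Suc.IH by (intro law.finite_measure_mono) auto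
    then show ?case unfolding iterate_Suc
      using dens[OF Suc.prems] le_H_op_iff[OF iterate_measurable r t] by (meson order_trans)
  qed
  then show "t \<le> continuum_r_coreness r f x" using x by (simp add: le_continuum_r_coreness_iff)
qed

end

end

section \<open>Discrete coreness and the empirical measure\<close>

lemma degree_neighborhood_subgraph_le:
  assumes H: "subgraph H (neighborhood_graph r x S)" and S: "finite S"
  shows "degree H v \<le> card {u \<in> fst H. u \<noteq> v \<and> dist v u \<le> r}"
proof -
  have fin: "finite (fst H)"
    using H S by (auto simp: subgraph_def neighborhood_graph_def intro: finite_subset)
  have "{e \<in> snd H. v \<in> e} \<subseteq> (\<lambda>u. {v, u}) ` {u \<in> fst H. u \<noteq> v \<and> dist v u \<le> r}"
  proof
    fix e assume e: "e \<in> {e \<in> snd H. v \<in> e}"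
    then have "e \<in> snd (neighborhood_graph r x S)" "e \<subseteq> fst H"
      using H by (auto simp: subgraph_def)
    then obtain a b where ab: "e = {a, b}" "a \<noteq> b" "dist a b \<le> r" "a \<in> fst H" "b \<in> fst H"
      by (auto simp: neighborhood_graph_def)
    have "v = a \<or> v = b" using e ab(1) by auto
    then show "e \<in> (\<lambda>u. {v, u}) ` {u \<in> fst H. u \<noteq> v \<and> dist v u \<le> r}"
    proof
      assume "v = a"
      then show ?thesis using ab by (intro image_eqI[of _ _ b]) auto
    next
      assume "v = b"
      then show ?thesis using ab by (intro image_eqI[of _ _ a]) (auto simp: dist_commute)
    qed
  qed
  then have "degree H v \<le> card ((\<lambda>u. {v, u}) ` {u \<in> fst H. u \<noteq> v \<and> dist v u \<le> r})"
    unfolding degree_def using fin by (intro card_mono) auto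
  also have "\<dots> \<le> card {u \<in> fst H. u \<noteq> v \<and> dist v u \<le> r}"
    using fin by (intro card_image_le) auto
  finally show ?thesis .
qed

lemma le_Min_degree_iff:
  assumes "subgraph H (neighborhood_graph r x S)" "x \<in> fst H" "finite S"
  shows "l \<le> (MIN v\<in>fst H. degree H v) \<longleftrightarrow> (\<forall>v\<in>fst H. l \<le> degree H v)"
proof -
  have "finite (fst H)"
    using assms by (auto simp: subgraph_def neighborhood_graph_def intro: finite_subset)
  then show ?thesis using assms(2) by (subst Min_ge_iff) auto
qed

lemma coreness_level_bounded:
  assumes "\<exists>H. subgraph H (neighborhood_graph r x S) \<and> x \<in> fst H \<and> l \<le> (MIN v\<in>fst H. degree H v)" "finite S"
  shows "l \<le> card (insert x S)"
proof -
  obtain H where H: "subgraph H (neighborhood_graph r x S)" "x \<in> fst H" "l \<le> (MIN v\<in>fst H. degree H v)"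
    using assms by blast
  have "l \<le> degree H x" using le_Min_degree_iff[OF H(1,2) assms(2)] H by blast
  also have "\<dots> \<le> card {u \<in> fst H. u \<noteq> x \<and> dist x u \<le> r}"
    by (rule degree_neighborhood_subgraph_le[OF H(1) assms(2)])
  also have "\<dots> \<le> card (insert x S)"
    using H(1) assms(2) by (intro card_mono) (auto simp: subgraph_def neighborhood_graph_def)
  finally show ?thesis .
qed

text \<open>
  Counting \<open>v\<close> itself along with its neighbours makes up for the vertex \<open>x\<close>, which need not be a sample
  point. So the degrees in an optimal subgraph are bounded by numbers of sample points without any loss.
\<close>

lemma discrete_coreness_witness:
  fixes x :: "'a::metric_space"
  assumes S: "finite S" and r: "0 < r"
  obtains V where "x \<in> V" "finite V" "\<And>v. v \<in> V \<Longrightarrow> discrete_coreness r x S \<le> card (S \<inter> (cball v r \<inter> V))"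
proof -
  let ?P = "\<lambda>l. \<exists>H. subgraph H (neighborhood_graph r x S) \<and> x \<in> fst H \<and> l \<le> (MIN v\<in>fst H. degree H v)"
  have "?P 0" by (intro exI[of _ "({x}, {})"]) (auto simp: subgraph_def neighborhood_graph_def)
  then have "?P (discrete_coreness r x S)"
    unfolding discrete_coreness_def using coreness_level_bounded[OF _ S]
    by (rule GreatestI_nat[of ?P 0 "card (insert x S)"])
  then obtain H where H: "subgraph H (neighborhood_graph r x S)" "x \<in> fst H"
    and min: "discrete_coreness r x S \<le> (MIN v\<in>fst H. degree H v)" by blast
  have sub: "fst H \<subseteq> insert x S" using H(1) by (auto simp: subgraph_def neighborhood_graph_def)
  then have fin: "finite (fst H)" using S by (auto intro: finite_subset)
  show ?thesis
  proof (rule that[of "fst H"])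
    fix v assume v: "v \<in> fst H"
    let ?N = "{u \<in> fst H. u \<noteq> v \<and> dist v u \<le> r}"
    have "discrete_coreness r x S \<le> degree H v" using le_Min_degree_iff[OF H S] min v by blast
    also have "\<dots> \<le> card ?N" by (rule degree_neighborhood_subgraph_le[OF H(1) S])
    finally have "Suc (discrete_coreness r x S) \<le> card (insert v ?N)" using fin by simp
    also have "\<dots> \<le> card (insert x (S \<inter> (cball v r \<inter> fst H)))"
      using S sub v r by (intro card_mono) auto
    also have "\<dots> \<le> Suc (card (S \<inter> (cball v r \<inter> fst H)))" by (rule card_insert_le_m1[OF zero_less_Suc, simplified]) simp
    finally show "discrete_coreness r x S \<le> card (S \<inter> (cball v r \<inter> fst H))" by simp
  qed (use H fin in auto)
qed

text \<open>
  In this direction the vertex \<open>v\<close> has to be removed from the count, which loses one neighbour.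
\<close>

lemma discrete_coreness_ge:
  fixes x :: "'a::metric_space"
  assumes S: "finite S" and x: "x \<in> A"
    and dens: "\<And>v. v \<in> A \<Longrightarrow> Suc l \<le> card (S \<inter> (cball v r \<inter> A))"
  shows "l \<le> discrete_coreness r x S"
proof -
  let ?P = "\<lambda>l. \<exists>H. subgraph H (neighborhood_graph r x S) \<and> x \<in> fst H \<and> l \<le> (MIN v\<in>fst H. degree H v)"
  define V where "V = insert x (S \<inter> A)"
  define H where "H = (V, {{u, v} |u v. u \<in> V \<and> v \<in> V \<and> u \<noteq> v \<and> dist u v \<le> r})"
  have H: "subgraph H (neighborhood_graph r x S)" "x \<in> fst H"
    by (auto simp: H_def V_def subgraph_def neighborhood_graph_def)
  have finV: "finite V" using S by (simp add: V_def)
  have "l \<le> degree H v" if "v \<in> V" for v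
  proof -
    have "v \<in> A" using that x by (auto simp: V_def)
    let ?N = "S \<inter> (cball v r \<inter> A) - {v}"
    have "Suc l \<le> card (S \<inter> (cball v r \<inter> A))" by (rule dens[OF \<open>v \<in> A\<close>])
    then have "l \<le> card ?N" using S by (simp add: card_Diff_singleton_if) (auto split: if_splits)
    also have "\<dots> = card ((\<lambda>u. {v, u}) ` ?N)"
      by (rule card_image[symmetric]) (auto simp: inj_on_def doubleton_eq_iff)
    also have "\<dots> \<le> degree H v"
      unfolding degree_def
    proof (rule card_mono)
      have "snd H \<subseteq> Pow V" by (auto simp: H_def)
      then show "finite {e \<in> snd H. v \<in> e}"
        using finV by (intro finite_subset[of "{e \<in> snd H. v \<in> e}" "Pow V"]) auto
      show "(\<lambda>u. {v, u}) ` ?N \<subseteq> {e \<in> snd H. v \<in> e}"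
      proof
        fix e assume "e \<in> (\<lambda>u. {v, u}) ` ?N"
        then obtain u where "u \<in> ?N" "e = {v, u}" by blast
        then have "e = {v, u}" "u \<in> V" "v \<noteq> u" "dist v u \<le> r" by (auto simp: V_def)
        with that show "e \<in> {e \<in> snd H. v \<in> e}" unfolding H_def by auto
      qed
    qed
    finally show ?thesis .
  qed
  then have "?P l" using H by (intro exI[of _ H]) (simp add: le_Min_degree_iff[OF H S], simp add: H_def)
  then show ?thesis
    unfolding discrete_coreness_def using coreness_level_bounded[OF _ S]
    by (rule Greatest_le_nat[of ?P l "card (insert x S)"])
qed

definition empirical :: "nat \<Rightarrow> (nat \<Rightarrow> 'a::euclidean_space) \<Rightarrow> 'a measure" where
  "empirical n xs = distr (uniform_count_measure {1..n}) borel xs"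

lemma sets_empirical [simp]: "sets (empirical n xs) = sets borel"
  by (simp add: empirical_def)

lemma measurable_uniform_count_measure: "xs \<in> measurable (uniform_count_measure A) borel"
  by (simp add: measurable_cong_sets[OF sets_uniform_count_measure_count_space refl] measurable_count_space_eq1)

lemma finite_measure_empirical: "1 \<le> n \<Longrightarrow> finite_measure (empirical n xs)"
  unfolding empirical_def
  by (intro prob_space.finite_measure prob_space.prob_space_distr prob_space_uniform_count_measure
      measurable_uniform_count_measure) auto

lemma measure_empirical:
  assumes "1 \<le> n" "A \<in> sets borel"
  shows "measure (empirical n xs) A = real (card {i \<in> {1..n}. xs i \<in> A}) / real n"
proof -
  have "measure (empirical n xs) A = measure (uniform_count_measure {1..n}) (xs -` A \<inter> {1..n})"
    unfolding empirical_def using assms(2)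
    by (simp add: measure_distr[OF measurable_uniform_count_measure] space_uniform_count_measure)
  also have "xs -` A \<inter> {1..n} = {i \<in> {1..n}. xs i \<in> A}" by auto
  also have "measure (uniform_count_measure {1..n}) \<dots> = real (card {i \<in> {1..n}. xs i \<in> A}) / real n"
    using assms by (subst measure_uniform_count_measure) auto
  finally show ?thesis .
qed

lemma measure_empirical_inj:
  assumes "1 \<le> n" "A \<in> sets borel" "inj_on xs {1..n}"
  shows "measure (empirical n xs) A = real (card (xs ` {1..n} \<inter> A)) / real n"
proof -
  have "xs ` {1..n} \<inter> A = xs ` {i \<in> {1..n}. xs i \<in> A}" by auto
  also have "card \<dots> = card {i \<in> {1..n}. xs i \<in> A}"
    by (intro card_image inj_on_subset[OF assms(3)]) auto
  finally show ?thesis using measure_empirical[OF assms(1,2)] by simp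
qed

context
  fixes xs :: "nat \<Rightarrow> 'a::euclidean_space" and n :: nat and r :: real
  assumes n: "1 \<le> n" and r: "0 < r" and inj: "inj_on xs {1..n}"
begin

lemma good_at_discrete_coreness:
  "good_at (empirical n xs) r
     (1 / (real n * ball_volume TYPE('a) r) * real (discrete_coreness r x (xs ` {1..n}))) x"
proof -
  have V: "0 < ball_volume TYPE('a) r" using r by (rule ball_volume_pos)
  obtain W where W: "x \<in> W" "finite W"
    "\<And>v. v \<in> W \<Longrightarrow> discrete_coreness r x (xs ` {1..n}) \<le> card (xs ` {1..n} \<inter> (cball v r \<inter> W))"
    using discrete_coreness_witness[of "xs ` {1..n}" r x] r by auto
  have Wb: "W \<in> sets borel" using W(2) by (simp add: borel_closed finite_imp_closed)
  show ?thesis unfolding good_at_def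
  proof (intro bexI[of _ W] conjI ballI)
    fix v assume "v \<in> W"
    have "1 / (real n * ball_volume TYPE('a) r) * real (discrete_coreness r x (xs ` {1..n}))
        * ball_volume TYPE('a) r = real (discrete_coreness r x (xs ` {1..n})) / real n"
      using V by simp
    also have "\<dots> \<le> real (card (xs ` {1..n} \<inter> (cball v r \<inter> W))) / real n"
      by (intro divide_right_mono of_nat_mono W(3) \<open>v \<in> W\<close>) simp
    also have "\<dots> = measure (empirical n xs) (cball v r \<inter> W)"
      by (rule measure_empirical_inj[OF n _ inj, symmetric]) (intro sets.Int Wb borel_closed closed_cball)
    finally show "1 / (real n * ball_volume TYPE('a) r) * real (discrete_coreness r x (xs ` {1..n}))
        * ball_volume TYPE('a) r \<le> measure (empirical n xs) (cball v r \<inter> W)" .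
  qed (use W Wb in auto)
qed

lemma le_discrete_coreness_of_good_at:
  assumes "good_at (empirical n xs) r t x"
  shows "t \<le> 1 / (real n * ball_volume TYPE('a) r) * real (discrete_coreness r x (xs ` {1..n}))
    + 1 / (real n * ball_volume TYPE('a) r)"
proof -
  let ?N = "real n * ball_volume TYPE('a) r"
  let ?C = "discrete_coreness r x (xs ` {1..n})"
  have N: "0 < ?N" using ball_volume_pos[OF r, where 'a='a] n by simp
  obtain A where A: "A \<in> sets borel" "x \<in> A"
    and dens: "\<And>z. z \<in> A \<Longrightarrow> t * ball_volume TYPE('a) r \<le> measure (empirical n xs) (cball z r \<inter> A)"
    using assms by (auto simp: good_at_def)
  define m where "m = nat \<lceil>t * ?N\<rceil>"
  have m: "t * ?N \<le> real m" unfolding m_def by linarith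
  have card: "m \<le> card (xs ` {1..n} \<inter> (cball v r \<inter> A))" if "v \<in> A" for v
  proof -
    have "t * ball_volume TYPE('a) r \<le> real (card (xs ` {1..n} \<inter> (cball v r \<inter> A))) / real n"
      using dens[OF that] A by (subst (asm) measure_empirical_inj[OF n _ inj]) auto
    then have "t * ?N \<le> real (card (xs ` {1..n} \<inter> (cball v r \<inter> A)))"
      using n by (simp add: field_simps)
    then show ?thesis unfolding m_def by linarith
  qed
  have "m \<le> Suc ?C"
  proof (cases m)
    case (Suc l)
    have "l \<le> ?C" using card[unfolded Suc] by (intro discrete_coreness_ge[OF _ A(2)]) simp_all
    then show ?thesis using Suc by simp
  qed simp
  then have "t * ?N \<le> real ?C + 1" using m by linarith
  then have "t \<le> (real ?C + 1) / ?N" using N by (simp add: pos_le_divide_eq)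
  then show ?thesis by (simp add: add_divide_distrib)
qed

end

section \<open>Concentration of the empirical measure on grid cells\<close>

locale iid_sample = prob_space M + uniformly_continuous_density f
  for M :: "'w measure" and f :: "'a::euclidean_space \<Rightarrow> real" +
  fixes X :: "nat \<Rightarrow> 'w \<Rightarrow> 'a"
  assumes indep: "indep_vars (\<lambda>_. borel) X {1..}"
    and distributed: "1 \<le> i \<Longrightarrow> distributed M lborel (X i) (\<lambda>x. ennreal (f x))"
begin

lemma X_measurable: "1 \<le> i \<Longrightarrow> X i \<in> measurable M borel"
  using distributed_measurable[OF distributed, of i] by simp

lemma distr_X: "1 \<le> i \<Longrightarrow> distr M borel (X i) = law"
  using distributed_distr_eq_density[OF distributed, of i] by (simp cong: distr_cong)

text \<open>
  Coincidences between sample points have to be excluded, because the vertex set of the graph does not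
  record multiplicities whereas the empirical measure does.
\<close>

lemma AE_X_neq:
  assumes ij: "1 \<le> i" "1 \<le> j" "i \<noteq> j"
  shows "AE w in M. X i w \<noteq> X j w"
proof -
  have "indep_var (PiM {i} (\<lambda>_. borel)) (\<lambda>w. restrict (\<lambda>i. X i w) {i})
      (PiM {j} (\<lambda>_. borel)) (\<lambda>w. restrict (\<lambda>i. X i w) {j})"
    using ij by (intro indep_var_restrict[OF indep]) auto
  then have "indep_var borel ((\<lambda>g. g i) \<circ> (\<lambda>w. restrict (\<lambda>i. X i w) {i}))
      borel ((\<lambda>g. g j) \<circ> (\<lambda>w. restrict (\<lambda>i. X i w) {j}))"
    by (rule indep_var_compose) (auto intro: measurable_component_singleton)
  then have "indep_var borel (X i) borel (X j)" by (simp add: comp_def)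
  then have joint: "law \<Otimes>\<^sub>M law = distr M (borel \<Otimes>\<^sub>M borel) (\<lambda>w. (X i w, X j w))"
    using ij by (simp add: indep_var_distribution_eq distr_X)
  interpret P: pair_sigma_finite law law ..
  have "AE p in law \<Otimes>\<^sub>M law. fst p \<noteq> snd p"
  proof (rule P.AE_pair_measure)
    show "{p \<in> space (law \<Otimes>\<^sub>M law). fst p \<noteq> snd p} \<in> sets (law \<Otimes>\<^sub>M law)" by measurable
    have "AE y in law. x \<noteq> y" for x
      using AE_lborel_singleton[of x] by (subst AE_density) (auto elim!: eventually_mono)
    then show "AE x in law. AE y in law. fst (x, y) \<noteq> snd (x, y)" by simp
  qed
  moreover have [measurable]: "X i \<in> measurable M borel" "X j \<in> measurable M borel"
    using ij by (auto intro: X_measurable)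
  ultimately show ?thesis unfolding joint by (subst (asm) AE_distr_iff) auto
qed

lemma AE_inj_on: "AE w in M. inj_on (\<lambda>i. X i w) {1..}"
proof -
  have "AE w in M. \<forall>i j. 1 \<le> i \<and> 1 \<le> j \<and> i \<noteq> j \<longrightarrow> X i w \<noteq> X j w"
    unfolding AE_all_countable using AE_X_neq by (auto intro: AE_I2)
  then show ?thesis by (rule eventually_mono) (auto simp: inj_on_def)
qed

definition hits :: "'a set \<Rightarrow> nat \<Rightarrow> 'w \<Rightarrow> real" where
  "hits Q n w = (\<Sum>i\<in>{1..n}. indicator Q (X i w))"

lemma hits_eq_card: "hits Q n w = real (card {i \<in> {1..n}. X i w \<in> Q})"
  by (simp add: hits_def indicator_def sum.If_cases Int_def)

lemma hits_nonneg: "0 \<le> hits Q n w"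
  by (simp add: hits_eq_card)

context
  fixes Q :: "'a set" assumes Q [measurable]: "Q \<in> sets borel"
begin

lemma hits_measurable [measurable]: "hits Q n \<in> borel_measurable M"
  unfolding hits_def[abs_def] using X_measurable by measurable

lemma exp_hits: "exp (s * hits Q n w) = (\<Prod>i\<in>{1..n}. 1 + (exp s - 1) * indicator Q (X i w))"
  unfolding hits_def sum_distrib_left exp_sum[OF finite_atLeastAtMost]
  by (intro prod.cong) (auto simp: indicator_def)

lemma integrable_indicator_X: "1 \<le> i \<Longrightarrow> integrable M (\<lambda>w. indicator Q (X i w) :: real)"
  by (rule integrable_const_bound[of _ 1]) (auto intro!: X_measurable measurable_compose[OF X_measurable])

lemma integral_indicator_X:
  assumes "1 \<le> i"
  shows "(\<integral>w. indicator Q (X i w) \<partial>M) = measure law Q"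
proof -
  have "(\<integral>w. indicator Q (X i w) \<partial>M) = (\<integral>x. indicat_real Q x \<partial>distr M borel (X i))"
    using X_measurable[OF assms] by (subst integral_distr) auto
  also have "\<dots> = measure law Q" using assms by (simp add: distr_X)
  finally show ?thesis .
qed

lemma exp_hits_moment:
  shows "integrable M (\<lambda>w. exp (s * hits Q n w))"
    and "(\<integral>w. exp (s * hits Q n w) \<partial>M) = (1 + (exp s - 1) * measure law Q) ^ n"
proof -
  let ?Y = "\<lambda>i w. 1 + (exp s - 1) * indicator Q (X i w)"
  have ind: "indep_vars (\<lambda>_. borel) ?Y {1..n}"
    by (rule indep_vars_compose2[OF indep_vars_subset[OF indep]]) auto
  have int: "integrable M (?Y i)" if "i \<in> {1..n}" for i
    using that integrable_indicator_X[of i] by auto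
  show "integrable M (\<lambda>w. exp (s * hits Q n w))"
    unfolding exp_hits by (rule indep_vars_integrable[OF _ ind int]) auto
  have "(\<integral>w. exp (s * hits Q n w) \<partial>M) = (\<Prod>i\<in>{1..n}. \<integral>w. ?Y i w \<partial>M)"
    unfolding exp_hits by (rule indep_vars_lebesgue_integral[OF _ ind int]) auto
  also have "\<dots> = (\<Prod>i\<in>{1..n}. 1 + (exp s - 1) * measure law Q)"
    using integrable_indicator_X integral_indicator_X by (intro prod.cong) (auto simp: prob_space)
  finally show "(\<integral>w. exp (s * hits Q n w) \<partial>M) = (1 + (exp s - 1) * measure law Q) ^ n" by simp
qed

lemma exp_hits_moment_le:
  assumes "exp s - 1 \<le> c"
  shows "(\<integral>w. exp (s * hits Q n w) \<partial>M) \<le> exp (real n * measure law Q * c)"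
proof -
  have "- 1 * 1 \<le> (exp s - 1) * measure law Q"
  proof (cases "0 \<le> exp s - 1")
    case False
    have "- ((exp s - 1) * measure law Q) = (1 - exp s) * measure law Q" by (simp add: algebra_simps)
    also have "\<dots> \<le> 1 * 1" using False by (intro mult_mono) auto
    finally show ?thesis by simp
  qed (smt (verit) mult_nonneg_nonneg measure_nonneg)
  then have "(1 + (exp s - 1) * measure law Q) ^ n \<le> (exp (measure law Q * c)) ^ n"
  proof (intro power_mono)
    have "(exp s - 1) * measure law Q \<le> measure law Q * c"
      using assms mult_right_mono[OF assms, of "measure law Q"] by (simp add: mult.commute)
    also have "1 + \<dots> \<le> exp (measure law Q * c)" by (rule exp_ge_add_one_self)
    finally show "1 + (exp s - 1) * measure law Q \<le> exp (measure law Q * c)" by simp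
  qed simp
  then show ?thesis by (simp add: exp_hits_moment exp_of_nat_mult[symmetric] mult_ac)
qed

text \<open>
  Besides the usual exponential factor the bounds carry the factor \<open>n * measure law Q\<close>. It makes
  them summable over the infinitely many cells of a grid. It comes from applying Markov's inequality
  to \<open>exp (\<beta> * hits Q n) - 1\<close>, whose mean is small when few hits are expected.
\<close>

lemma hits_upper_tail:
  fixes n :: nat and \<beta> T :: real
  defines "y \<equiv> real n * measure law Q"
  assumes \<beta>: "0 < \<beta>" "\<beta> \<le> 1" "1 \<le> \<beta> * T" and y: "y * \<beta> \<le> T / 2"
  shows "prob {w \<in> space M. y + T < hits Q n w} \<le> 4 * y * exp (- (\<beta> * T / 2))"
proof -
  have y0: "0 \<le> y" by (simp add: y_def)
  define v where "v = y * (\<beta> + \<beta>\<^sup>2)"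
  have v0: "0 \<le> v" using y0 \<beta> by (simp add: v_def)
  define D where "D = exp (\<beta> * (y + T)) - 1"
  have big: "2 \<le> exp (\<beta> * (y + T))"
  proof -
    have "1 + 1 \<le> 1 + \<beta> * (y + T)" using \<beta>(3) mult_nonneg_nonneg[OF less_imp_le[OF \<beta>(1)] y0] unfolding distrib_left by linarith
    also have "\<dots> \<le> exp (\<beta> * (y + T))" by (rule exp_ge_add_one_self)
    finally show ?thesis by simp
  qed
  then have D: "0 < D" "exp (\<beta> * (y + T)) / 2 \<le> D" unfolding D_def by linarith+
  let ?u = "\<lambda>w. exp (\<beta> * hits Q n w) - 1"
  have int: "integrable M ?u" using exp_hits_moment(1)[of \<beta> n] by simp
  have "prob {w \<in> space M. y + T < hits Q n w} \<le> prob {w \<in> space M. D \<le> ?u w}"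
    using \<beta> by (intro finite_measure_mono) (auto simp: D_def)
  also have "\<dots> \<le> (\<integral>w. ?u w \<partial>M) / D"
    using int D(1) \<beta> hits_nonneg by (intro integral_Markov_inequality_measure[where A="{}"]) auto
  also have "(\<integral>w. ?u w \<partial>M) \<le> v * exp v"
  proof -
    have "(\<integral>w. ?u w \<partial>M) = (\<integral>w. exp (\<beta> * hits Q n w) \<partial>M) - 1"
      using exp_hits_moment(1)[of \<beta> n] by (simp add: prob_space)
    also have "\<dots> \<le> exp v - 1"
    proof -
      have "exp \<beta> - 1 \<le> \<beta> + \<beta>\<^sup>2" using exp_bound[of \<beta>] \<beta> by simp
      from exp_hits_moment_le[OF this, of n] show ?thesis by (simp add: v_def y_def)
    qed
    also have "\<dots> \<le> v * exp v"
    proof -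
      have "(1 - v) * exp v \<le> exp (- v) * exp v"
        using exp_ge_add_one_self[of "- v"] by (intro mult_right_mono) auto
      then show ?thesis by (simp add: exp_minus algebra_simps)
    qed
    finally show ?thesis .
  qed
  then have "(\<integral>w. ?u w \<partial>M) / D \<le> v * exp v / D" using D by (intro divide_right_mono) auto
  also have "v * exp v / D \<le> v * exp v / (exp (\<beta> * (y + T)) / 2)"
    using D v0 by (intro divide_left_mono) auto
  also have "\<dots> = 2 * v * exp (v - \<beta> * (y + T))" by (simp add: exp_diff)
  also have "\<dots> \<le> 2 * (2 * y) * exp (- (\<beta> * T / 2))"
  proof (intro mult_mono)
    have "\<beta> * \<beta> \<le> 1 * 1" using \<beta> by (intro mult_mono) auto
    then have "y * (\<beta> + \<beta>\<^sup>2) \<le> y * 2" using y0 \<beta> by (intro mult_left_mono) (auto simp: power2_eq_square)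
    then show "v \<le> 2 * y" by (simp add: v_def)
    have "\<beta> * (y * \<beta>) \<le> \<beta> * (T / 2)" using y \<beta> by (intro mult_left_mono) auto
    then show "exp (v - \<beta> * (y + T)) \<le> exp (- (\<beta> * T / 2))"
      by (simp add: v_def power2_eq_square algebra_simps)
  qed (use v0 y0 in auto)
  finally show ?thesis by simp
qed

text \<open>
  Fewer than \<open>y - T\<close> hits are possible only for \<open>y > T \<ge> 1\<close>, and then the extra factor \<open>y\<close> is harmless.
\<close>

lemma hits_lower_tail:
  fixes n :: nat and \<beta> T :: real
  defines "y \<equiv> real n * measure law Q"
  assumes \<beta>: "0 < \<beta>" "1 \<le> T" and y: "y * \<beta> \<le> T / 2"
  shows "prob {w \<in> space M. hits Q n w < y - T} \<le> y * exp (- (\<beta> * T / 2))"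
proof (cases "y \<le> T")
  case True
  have empty: "{w \<in> space M. hits Q n w < y - T} = {}"
  proof (rule ccontr)
    assume "{w \<in> space M. hits Q n w < y - T} \<noteq> {}"
    then obtain w where "hits Q n w < y - T" by blast
    with True hits_nonneg[of Q n w] show False by linarith
  qed
  show ?thesis unfolding empty by (simp add: y_def)
next
  case False
  have y1: "1 \<le> y" using False \<beta> by simp
  \<comment> \<open>From \<open>exp (- \<beta>) \<le> 1 / (1 + \<beta>)\<close> and \<open>(1 - \<beta> + \<beta> ^ 2) * (1 + \<beta>) = 1 + \<beta> ^ 3\<close>.\<close>
  have exp_le: "exp (- \<beta>) - 1 \<le> - \<beta> + \<beta>\<^sup>2"
  proof -
    have "1 \<le> (1 - \<beta> + \<beta>\<^sup>2) * (1 + \<beta>)"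
      using \<beta> by (simp add: power2_eq_square algebra_simps)
    also have "\<dots> \<le> (1 - \<beta> + \<beta>\<^sup>2) * exp \<beta>"
    proof (rule mult_left_mono)
      have "0 \<le> (\<beta> - 1/2)\<^sup>2" by simp
      then show "0 \<le> 1 - \<beta> + \<beta>\<^sup>2" by (simp add: power2_eq_square algebra_simps)
    qed (rule exp_ge_add_one_self)
    finally show ?thesis by (simp add: exp_minus field_simps)
  qed
  have "prob {w \<in> space M. hits Q n w < y - T} \<le> prob {w \<in> space M. exp (- \<beta> * (y - T)) \<le> exp (- \<beta> * hits Q n w)}"
    using \<beta> by (intro finite_measure_mono) auto
  also have "\<dots> \<le> (\<integral>w. exp (- \<beta> * hits Q n w) \<partial>M) / exp (- \<beta> * (y - T))"
    by (intro integral_Markov_inequality_measure[where A="{}"] exp_hits_moment) auto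
  also have "\<dots> \<le> exp (y * (- \<beta> + \<beta>\<^sup>2)) / exp (- \<beta> * (y - T))"
    unfolding y_def by (intro divide_right_mono exp_hits_moment_le exp_le) simp
  also have "\<dots> = exp (y * (- \<beta> + \<beta>\<^sup>2) - (- \<beta> * (y - T)))" by (simp only: exp_diff)
  also have "\<dots> \<le> exp (- (\<beta> * T / 2))"
  proof -
    have "\<beta> * (y * \<beta>) \<le> \<beta> * (T / 2)" using y \<beta> by (intro mult_left_mono) auto
    then show ?thesis by (simp add: power2_eq_square algebra_simps)
  qed
  also have "\<dots> \<le> y * exp (- (\<beta> * T / 2))" using y1 by simp
  finally show ?thesis .
qed

lemma hits_deviation:
  fixes n :: nat and \<beta> T :: real
  assumes \<beta>: "0 < \<beta>" "\<beta> \<le> 1" "1 \<le> T" "1 \<le> \<beta> * T" and y: "real n * measure law Q * \<beta> \<le> T / 2"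
  shows "prob {w \<in> space M. T < \<bar>hits Q n w - real n * measure law Q\<bar>}
    \<le> 5 * (real n * exp (- (\<beta> * T / 2))) * measure law Q"
proof -
  let ?y = "real n * measure law Q"
  have "prob {w \<in> space M. T < \<bar>hits Q n w - ?y\<bar>}
    \<le> prob ({w \<in> space M. ?y + T < hits Q n w} \<union> {w \<in> space M. hits Q n w < ?y - T})"
  proof (rule finite_measure_mono)
    have "?y + T < x \<or> x < ?y - T" if "T < \<bar>x - ?y\<bar>" for x using that by linarith
    then show "{w \<in> space M. T < \<bar>hits Q n w - ?y\<bar>}
      \<subseteq> {w \<in> space M. ?y + T < hits Q n w} \<union> {w \<in> space M. hits Q n w < ?y - T}" by blast
  qed measurable
  also have "\<dots> \<le> prob {w \<in> space M. ?y + T < hits Q n w} + prob {w \<in> space M. hits Q n w < ?y - T}"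
    by (intro measure_Un_le) measurable
  also have "\<dots> \<le> 4 * ?y * exp (- (\<beta> * T / 2)) + ?y * exp (- (\<beta> * T / 2))"
    using \<beta> y by (intro add_mono hits_upper_tail hits_lower_tail) auto
  finally show ?thesis by (simp add: algebra_simps)
qed

end

lemma cell_deviation_prob:
  fixes n :: nat and \<beta> T :: real
  assumes \<beta>: "0 < \<beta>" "\<beta> \<le> 1" "1 \<le> T" "1 \<le> \<beta> * T"
    and y: "\<And>j. real n * measure law (grid_cell h j) * \<beta> \<le> T / 2"
  shows "prob (\<Union>j. {w \<in> space M. T < \<bar>hits (grid_cell h j) n w - real n * measure law (grid_cell h j)\<bar>})
    \<le> 5 * (real n * exp (- (\<beta> * T / 2)))"
proof -
  let ?B = "\<lambda>j. {w \<in> space M. T < \<bar>hits (grid_cell h j) n w - real n * measure law (grid_cell h j)\<bar>}"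
  let ?c = "5 * (real n * exp (- (\<beta> * T / 2)))"
  have "(\<lambda>j. measure law (grid_cell h j)) sums measure law (\<Union>j. grid_cell h j)"
    by (intro law.finite_measure_UNION disjoint_grid_cell) auto
  then have "(\<lambda>j. measure law (grid_cell h j)) sums 1"
    using law.prob_space by (simp add: Union_grid_cell)
  then have s: "(\<lambda>j. ?c * measure law (grid_cell h j)) sums (?c * 1)" by (intro sums_mult)
  have le: "prob (?B j) \<le> ?c * measure law (grid_cell h j)" for j
    using hits_deviation[OF grid_cell_measurable \<beta> y] .
  have sm: "summable (\<lambda>j. prob (?B j))"
    by (rule summable_comparison_test'[OF sums_summable[OF s], of 0]) (use le in auto)
  have "prob (\<Union>j. ?B j) \<le> (\<Sum>j. prob (?B j))"
  proof (rule finite_measure_subadditive_countably[OF _ sm])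
    have [measurable]: "hits (grid_cell h j) n \<in> borel_measurable M" for j
      by (rule hits_measurable) simp
    show "range ?B \<subseteq> events" by auto
  qed
  also have "\<dots> \<le> (\<Sum>j. ?c * measure law (grid_cell h j))"
    by (rule suminf_le[OF le sm sums_summable[OF s]])
  also have "\<dots> = ?c" using sums_unique[OF s] by simp
  finally show ?thesis .
qed

lemma measure_law_grid_cell_le:
  assumes "\<And>x. f x \<le> F" "0 < h" "0 \<le> F"
  shows "measure law (grid_cell h j) \<le> F * h ^ DIM('a)"
proof (cases "grid_cell h j = ({} :: 'a set)")
  case True
  then show ?thesis using assms by simp
next
  case False
  then obtain w :: 'a where w: "w \<in> grid_cell h j" by blast
  have "grid_cell h j \<subseteq> cball w (real DIM('a) * h)"
    using dist_grid_cell[OF assms(2) w] by auto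
  then have "grid_cell h j \<in> fmeasurable (lborel :: 'a measure)"
    by (intro bounded_borel_fmeasurable) auto
  from measure_law_le[OF this assms(1)] show ?thesis
    by (simp add: measure_grid_cell[OF assms(2) w])
qed

text \<open>
  A cell of side \<open>g * r n\<close> receives on average at most a constant times \<open>T n = \<eta> * n * r n ^ d\<close> points, so
  deviations of size \<open>T n\<close> have probability exponentially small in \<open>T n\<close>. Since \<open>T n\<close> outgrows
  \<open>ln n\<close>, the probability that some cell deviates is summable, and the Borel--Cantelli lemma applies.
\<close>

lemma AE_empirical_close_on_cells:
  fixes r :: "nat \<Rightarrow> real"
  assumes r: "\<And>n. 1 \<le> n \<Longrightarrow> 0 < r n"
    and rate: "filterlim (\<lambda>n. real n * r n ^ DIM('a) / ln (real n)) at_top sequentially"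
    and g: "0 < g" and \<eta>: "0 < \<eta>"
  shows "AE w in M. \<forall>\<^sub>F n in sequentially. \<forall>j.
    \<bar>measure (empirical n (\<lambda>i. X i w)) (grid_cell (g * r n) j) - measure law (grid_cell (g * r n) j)\<bar>
      \<le> \<eta> * r n ^ DIM('a)"
proof -
  let ?d = "DIM('a)"
  obtain F where F: "0 < F" "\<And>x. f x \<le> F" using bounded_above by blast
  define T where "T n = \<eta> * (real n * r n ^ ?d)" for n
  define \<beta> where "\<beta> = min 1 (\<eta> / (2 * F * g ^ ?d))"
  have \<beta>: "0 < \<beta>" "\<beta> \<le> 1" using \<eta> F g by (auto simp: \<beta>_def)
  have \<beta>F: "F * g ^ ?d * \<beta> \<le> \<eta> / 2"
  proof -
    have "F * g ^ ?d * \<beta> \<le> F * g ^ ?d * (\<eta> / (2 * F * g ^ ?d))"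
      using F g by (intro mult_left_mono) (auto simp: \<beta>_def)
    then show ?thesis using F g by simp
  qed
  define B where "B n = (\<Union>j. {w \<in> space M.
    T n < \<bar>hits (grid_cell (g * r n) j) n w - real n * measure law (grid_cell (g * r n) j)\<bar>})" for n
  have hm[measurable]: "hits (grid_cell h j) n \<in> borel_measurable M" for h j n
    by (rule hits_measurable) simp
  have Bm: "B n \<in> events" for n unfolding B_def by (intro sets.countable_UN) auto
  \<comment> \<open>This choice gives \<open>\<beta> * T n / 2 \<ge> 3 * ln n\<close>, hence the summable bound \<open>5 / n ^ 2\<close> below.\<close>
  define K where "K = 6 / (\<beta> * \<eta>)"
  have K: "0 < K" using \<beta> \<eta> by (simp add: K_def)
  have ev: "\<forall>\<^sub>F n in sequentially. 3 \<le> n \<and> K \<le> real n * r n ^ ?d / ln (real n)"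
    using eventually_conj[OF eventually_ge_at_top[of 3] filterlim_at_top[THEN iffD1, OF rate, rule_format, of K]] .
  have "\<forall>\<^sub>F n in sequentially. norm (prob (B n)) \<le> 5 * inverse (real n ^ 2)"
    using ev
  proof eventually_elim
    case (elim n)
    then have n: "3 \<le> n" by simp
    have rn: "0 < r n" using n by (intro r) simp
    have ln1: "1 \<le> ln (real n)"
    proof -
      have "exp 1 \<le> real n" using exp_le n by linarith
      then show ?thesis using n by (simp add: ln_ge_iff)
    qed
    have "K * ln (real n) \<le> real n * r n ^ ?d" using elim ln1 by (simp add: pos_le_divide_eq)
    then have "\<beta> * \<eta> * (K * ln (real n)) \<le> \<beta> * \<eta> * (real n * r n ^ ?d)"
      using \<beta> \<eta> by (intro mult_left_mono) auto
    then have \<beta>T: "6 * ln (real n) \<le> \<beta> * T n"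
      using \<beta> \<eta> by (simp add: K_def T_def mult.assoc)
    have "0 \<le> T n" using rn \<eta> by (simp add: T_def)
    then have "\<beta> * T n \<le> 1 * T n" using \<beta> by (intro mult_right_mono) auto
    then have T1: "1 \<le> T n" "1 \<le> \<beta> * T n" using \<beta>T ln1 by linarith+
    have y: "real n * measure law (grid_cell (g * r n) j) * \<beta> \<le> T n / 2" for j
    proof -
      have "real n * measure law (grid_cell (g * r n) j) * \<beta> \<le> real n * (F * (g * r n) ^ ?d) * \<beta>"
        using F g rn \<beta> by (intro mult_right_mono mult_left_mono measure_law_grid_cell_le) auto
      also have "\<dots> = (F * g ^ ?d * \<beta>) * (real n * r n ^ ?d)" by (simp add: power_mult_distrib mult_ac)
      also have "\<dots> \<le> \<eta> / 2 * (real n * r n ^ ?d)" using \<beta>F rn by (intro mult_right_mono) auto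
      finally show ?thesis by (simp add: T_def)
    qed
    have "prob (B n) \<le> 5 * (real n * exp (- (\<beta> * T n / 2)))"
      unfolding B_def by (rule cell_deviation_prob[OF \<beta> T1 y])
    also have "exp (- (\<beta> * T n / 2)) \<le> exp (- (real 3 * ln (real n)))" using \<beta>T by simp
    also have "\<dots> = inverse (real n ^ 3)"
      using n unfolding exp_minus exp_of_nat_mult by simp
    finally have "prob (B n) \<le> 5 * (real n * inverse (real n ^ 3))" using n by simp
    also have "\<dots> = 5 * inverse (real n ^ 2)" using n by (simp add: power3_eq_cube power2_eq_square)
    finally show ?case by simp
  qed
  then have "summable (\<lambda>n. prob (B n))"
    by (rule summable_comparison_test_ev) (intro summable_mult inverse_power_summable, simp)
  then have "AE w in M. \<forall>\<^sub>F n in sequentially. w \<in> space M - B n"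
    using Bm by (intro borel_cantelli_AE1) (auto simp: less_top[symmetric])
  then show ?thesis
  proof (rule AE_mp, intro AE_I2 impI)
    fix w assume "w \<in> space M" and w: "\<forall>\<^sub>F n in sequentially. w \<in> space M - B n"
    from w eventually_ge_at_top[of 1]
    show "\<forall>\<^sub>F n in sequentially. \<forall>j.
      \<bar>measure (empirical n (\<lambda>i. X i w)) (grid_cell (g * r n) j) - measure law (grid_cell (g * r n) j)\<bar>
      \<le> \<eta> * r n ^ DIM('a)"
    proof eventually_elim
      case (elim n)
      show ?case
      proof
        fix j
        let ?p = "measure law (grid_cell (g * r n) j)"
        have n: "0 < real n" using elim by simp
        have "\<bar>hits (grid_cell (g * r n) j) n w - real n * ?p\<bar> \<le> T n"
          using elim by (auto simp: B_def not_less)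
        then have "\<bar>hits (grid_cell (g * r n) j) n w / real n - ?p\<bar> \<le> T n / real n"
        proof -
          have "hits (grid_cell (g * r n) j) n w / real n - ?p = (hits (grid_cell (g * r n) j) n w - real n * ?p) / real n"
            using n by (simp add: diff_divide_distrib)
          moreover assume "\<bar>hits (grid_cell (g * r n) j) n w - real n * ?p\<bar> \<le> T n"
          ultimately show ?thesis using n by (simp add: abs_divide divide_right_mono)
        qed
        moreover have "T n / real n = \<eta> * r n ^ ?d" using n by (simp add: T_def)
        ultimately show "\<bar>measure (empirical n (\<lambda>i. X i w)) (grid_cell (g * r n) j) - ?p\<bar> \<le> \<eta> * r n ^ ?d"
          using elim by (simp add: measure_empirical hits_eq_card)
      qed
    qed
  qed
qed

end

section \<open>Convergence of the coreness\<close>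

context uniformly_continuous_density
begin

definition cells_close :: "real \<Rightarrow> real \<Rightarrow> 'a measure \<Rightarrow> real \<Rightarrow> bool" where
  "cells_close g \<eta> \<nu> r \<longleftrightarrow> finite_measure \<nu> \<and> sets \<nu> = sets borel \<and>
     (\<forall>j. \<bar>measure \<nu> (grid_cell (g * r) j) - measure law (grid_cell (g * r) j)\<bar> \<le> \<eta> * r ^ DIM('a))"

text \<open>
  The thickening radius \<open>\<zeta>\<close> comes from the modulus of continuity of \<open>f\<close> and depends on neither scale, so the
  two scales need only be small; neither has to be the smaller one.
\<close>

lemma good_at_transfer_cells:
  assumes "0 < \<delta>"
  obtains g \<eta> r0 where "0 < g" "0 < \<eta>" "0 < r0"
    "\<forall>\<mu> \<nu> r s t x. cells_close g \<eta> \<mu> r \<longrightarrow> cells_close g \<eta> \<nu> s \<longrightarrow> 0 < r \<longrightarrow> r < r0 \<longrightarrow> 0 < s \<longrightarrow> s < r0 \<longrightarrow>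
       good_at \<mu> r t x \<longrightarrow> good_at \<nu> s (t - 5 * \<delta>) x"
proof -
  obtain k g \<eta> r1 where c: "0 < k" "k \<le> 1" "0 < g" "0 < \<eta>" "0 < r1"
    and reg: "\<And>r \<nu>. \<lbrakk>0 < r; r < r1; finite_measure \<nu>; sets \<nu> = sets borel;
       \<And>j. \<bar>measure \<nu> (grid_cell (g * r) j) - measure law (grid_cell (g * r) j)\<bar> \<le> \<eta> * r ^ DIM('a)\<rbrakk>
      \<Longrightarrow> caps_regular f \<nu> r k \<delta>"
    using caps_regular_of_grid_cells[OF assms] by metis
  obtain \<rho> where \<rho>: "0 < \<rho>" "\<And>x y. dist x y < \<rho> \<Longrightarrow> \<bar>f x - f y\<bar> \<le> \<delta>"
    using oscillation[OF assms] by blast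
  define \<zeta> where "\<zeta> = \<rho> / 4"
  have \<zeta>: "0 < \<zeta>" "\<And>x y. dist x y < 4 * \<zeta> \<Longrightarrow> \<bar>f x - f y\<bar> \<le> \<delta>"
    using \<rho> by (simp_all add: \<zeta>_def)
  show ?thesis
  proof (rule that[of g \<eta> "min r1 (min (k * \<zeta>) (\<zeta> / 2))"])
    let ?r0 = "min r1 (min (k * \<zeta>) (\<zeta> / 2))"
    show "\<forall>\<mu> \<nu> r s t x. cells_close g \<eta> \<mu> r \<longrightarrow> cells_close g \<eta> \<nu> s \<longrightarrow> 0 < r \<longrightarrow> r < ?r0 \<longrightarrow> 0 < s \<longrightarrow> s < ?r0 \<longrightarrow>
       good_at \<mu> r t x \<longrightarrow> good_at \<nu> s (t - 5 * \<delta>) x"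
    proof (intro allI impI)
      fix \<mu> \<nu> :: "'a measure" and r s t :: real and x :: 'a
      assume "cells_close g \<eta> \<mu> r" "cells_close g \<eta> \<nu> s"
        and r: "0 < r" "r < min r1 (min (k * \<zeta>) (\<zeta> / 2))"
        and s: "0 < s" "s < min r1 (min (k * \<zeta>) (\<zeta> / 2))"
        and good: "good_at \<mu> r t x"
      then have \<mu>: "finite_measure \<mu>" "sets \<mu> = sets borel" "cells_close g \<eta> \<mu> r"
        and \<nu>: "finite_measure \<nu>" "sets \<nu> = sets borel" "cells_close g \<eta> \<nu> s"
        by (auto simp: cells_close_def)
      have "caps_regular f \<mu> r k \<delta>" "caps_regular f \<nu> s k \<delta>"
        using \<mu> \<nu> r s by (auto intro!: reg simp: cells_close_def)
      then show "good_at \<nu> s (t - 5 * \<delta>) x"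
        using r s c assms by (intro good_at_transfer[OF \<mu>(1,2) _ \<nu>(1,2) _ \<zeta>(2) _ _ _ _ _ _ _ _ good]) auto
    qed
  qed (use c \<zeta> in auto)
qed

lemma cells_close_law: "0 < \<eta> \<Longrightarrow> 0 < r \<Longrightarrow> cells_close g \<eta> law r"
  by (simp add: cells_close_def law.finite_measure_axioms)

lemma good_at_continuum_r_coreness: "0 < r \<Longrightarrow> good_at law r (continuum_r_coreness r f x) x"
  using le_continuum_r_coreness_iff_good_at continuum_r_coreness_nonneg by blast

lemma le_continuum_r_coreness:
  assumes "0 < r" "good_at law r t x"
  shows "t \<le> continuum_r_coreness r f x"
  using assms le_continuum_r_coreness_iff_good_at[of r t x] continuum_r_coreness_nonneg[of r x]
  by (cases "0 \<le> t") auto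

text \<open>
  Transfer from the law to itself between two arbitrary small scales makes the coreness a Cauchy
  family as the scale tends to zero.
\<close>

lemma tendsto_continuum_coreness:
  "((\<lambda>r. continuum_r_coreness r f x) \<longlongrightarrow> continuum_coreness f x) (at_right 0)"
proof -
  let ?C = "\<lambda>r. continuum_r_coreness r f x"
  have cauchy: "\<exists>r0>0. \<forall>r s. 0 < r \<and> r < r0 \<and> 0 < s \<and> s < r0 \<longrightarrow> \<bar>?C r - ?C s\<bar> \<le> e" if e: "0 < e" for e
  proof -
    have e5: "0 < e / 5" using e by simp
    obtain g \<eta> r0 where "0 < g" "0 < \<eta>" and r0: "0 < r0"
      and transfer: "\<forall>\<mu> \<nu> r s t x. cells_close g \<eta> \<mu> r \<longrightarrow> cells_close g \<eta> \<nu> s \<longrightarrow> 0 < r \<longrightarrow> r < r0 \<longrightarrow> 0 < s \<longrightarrow> s < r0 \<longrightarrow>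
       good_at \<mu> r t x \<longrightarrow> good_at \<nu> s (t - 5 * (e / 5)) x"
      by (rule good_at_transfer_cells[OF e5])
    have "?C r - e \<le> ?C s" if rs: "0 < r" "r < r0" "0 < s" "s < r0" for r s
    proof -
      have "good_at law s (?C r - 5 * (e / 5)) x"
        using rs \<open>0 < \<eta>\<close>
        by (intro transfer[rule_format, of law r law s] cells_close_law good_at_continuum_r_coreness) auto
      then show ?thesis using le_continuum_r_coreness[OF rs(3)] by simp
    qed
    then have "\<forall>r s. 0 < r \<and> r < r0 \<and> 0 < s \<and> s < r0 \<longrightarrow> \<bar>?C r - ?C s\<bar> \<le> e"
      by (smt (verit))
    with r0 show ?thesis by blast
  qed
  define u where "u n = ?C (inverse (real (Suc n)))" for n
  have small: "\<exists>N. \<forall>n\<ge>N. inverse (real (Suc n)) < r0" if r0: "0 < r0" for r0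
    using order_tendstoD(2)[OF LIMSEQ_inverse_real_of_nat r0] by (simp add: eventually_sequentially)
  have "Cauchy u"
  proof (rule CauchyI)
    fix e :: real assume e: "0 < e"
    then have "0 < e / 2" by simp
    from cauchy[OF this] obtain r0 where r0: "0 < r0" "\<forall>r s. 0 < r \<and> r < r0 \<and> 0 < s \<and> s < r0 \<longrightarrow> \<bar>?C r - ?C s\<bar> \<le> e / 2"
      by blast
    obtain N where N: "\<forall>n\<ge>N. inverse (real (Suc n)) < r0" using small[OF r0(1)] by blast
    have "norm (u m - u n) < e" if "N \<le> m" "N \<le> n" for m n
    proof -
      have "\<bar>u m - u n\<bar> \<le> e / 2" unfolding u_def using r0(2) N that by simp
      then show ?thesis using e by simp
    qed
    then show "\<exists>N. \<forall>m\<ge>N. \<forall>n\<ge>N. norm (u m - u n) < e" by blast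
  qed
  then obtain L where L: "u \<longlonglongrightarrow> L" using Cauchy_convergent_iff by (auto simp: convergent_def)
  have "(?C \<longlongrightarrow> L) (at_right 0)"
  proof (rule tendstoI)
    fix e :: real assume e: "0 < e"
    then have "0 < e / 2" by simp
    from cauchy[OF this] obtain r0 where r0: "0 < r0" "\<forall>r s. 0 < r \<and> r < r0 \<and> 0 < s \<and> s < r0 \<longrightarrow> \<bar>?C r - ?C s\<bar> \<le> e / 2"
      by blast
    obtain N where N: "\<forall>n\<ge>N. inverse (real (Suc n)) < r0" using small[OF r0(1)] by blast
    have "dist (?C r) L < e" if r: "0 < r" "r < r0" for r
    proof -
      have "(\<lambda>n. \<bar>?C r - u n\<bar>) \<longlonglongrightarrow> \<bar>?C r - L\<bar>" by (intro tendsto_intros L)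
      moreover have "\<forall>n\<ge>N. \<bar>?C r - u n\<bar> \<le> e / 2" unfolding u_def using r0(2) N r by simp
      ultimately have "\<bar>?C r - L\<bar> \<le> e / 2" by (intro LIMSEQ_le_const2) auto
      then show ?thesis using e by (simp add: dist_real_def)
    qed
    then show "\<forall>\<^sub>F r in at_right 0. dist (?C r) L < e"
      unfolding eventually_at_right_field using r0(1) by auto
  qed
  then show ?thesis
    unfolding continuum_coreness_def using tendsto_Lim[OF trivial_limit_at_right_real] by metis
qed

text \<open>
  The law is compared with \<open>\<nu>\<close> at a fixed small scale \<open>r\<close>, while its own scale \<open>s\<close> is free to tend
  to zero. The constants do not depend on \<open>x\<close>; this is where the uniformity of the convergence comes from.
\<close>

lemma good_levels_near_continuum_coreness:
  assumes \<delta>: "0 < \<delta>"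
  obtains g \<eta> r0 where "0 < g" "0 < \<eta>" "0 < r0"
    "\<forall>\<nu> r t x. cells_close g \<eta> \<nu> r \<longrightarrow> 0 < r \<longrightarrow> r < r0 \<longrightarrow> good_at \<nu> r t x \<longrightarrow>
      t \<le> continuum_coreness f x + \<delta>"
    "\<forall>\<nu> r x. cells_close g \<eta> \<nu> r \<longrightarrow> 0 < r \<longrightarrow> r < r0 \<longrightarrow>
      good_at \<nu> r (continuum_coreness f x - \<delta>) x"
proof -
  have \<delta>10: "0 < \<delta> / 10" using \<delta> by simp
  obtain g \<eta> r0 where c: "0 < g" "0 < \<eta>" "0 < r0"
    and transfer: "\<forall>\<mu> \<nu> r s t x. cells_close g \<eta> \<mu> r \<longrightarrow> cells_close g \<eta> \<nu> s \<longrightarrow> 0 < r \<longrightarrow> r < r0 \<longrightarrow> 0 < s \<longrightarrow> s < r0 \<longrightarrow>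
       good_at \<mu> r t x \<longrightarrow> good_at \<nu> s (t - 5 * (\<delta> / 10)) x"
    by (rule good_at_transfer_cells[OF \<delta>10])
  have ev: "\<forall>\<^sub>F s in at_right 0. 0 < s \<and> s < r0"
    using c(3) eventually_at_right_real by (auto elim!: eventually_mono)
  show ?thesis
  proof (rule that[OF c]; intro allI impI)
    fix \<nu> :: "'a measure" and r t :: real and x :: 'a
    assume \<nu>: "cells_close g \<eta> \<nu> r" and r: "0 < r" "r < r0"
      and good: "good_at \<nu> r t x"
    have "\<forall>\<^sub>F s in at_right 0. t - \<delta> / 2 \<le> continuum_r_coreness s f x"
      using ev
    proof eventually_elim
      case (elim s)
      then have "good_at law s (t - 5 * (\<delta> / 10)) x"
        using r c \<nu> good by (intro transfer[rule_format, of \<nu> r law s] cells_close_law) auto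
      then show ?case using le_continuum_r_coreness[of s] elim by simp
    qed
    from tendsto_lowerbound[OF tendsto_continuum_coreness this trivial_limit_at_right_real]
    show "t \<le> continuum_coreness f x + \<delta>" using \<delta> by simp
  next
    fix \<nu> :: "'a measure" and r :: real and x :: 'a
    assume \<nu>: "cells_close g \<eta> \<nu> r" and r: "0 < r" "r < r0"
    have "continuum_coreness f x - \<delta> / 2 < continuum_coreness f x" using \<delta> by simp
    from eventually_conj[OF ev order_tendstoD(1)[OF tendsto_continuum_coreness this]]
    obtain s where s: "0 < s" "s < r0" "continuum_coreness f x - \<delta> / 2 < continuum_r_coreness s f x"
      using eventually_happens'[OF trivial_limit_at_right_real] by auto
    have "good_at \<nu> r (continuum_r_coreness s f x - 5 * (\<delta> / 10)) x"
      using r c \<nu> s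
      by (intro transfer[rule_format, of law s \<nu> r] cells_close_law good_at_continuum_r_coreness) auto
    then obtain S where S: "S \<in> sets borel" "x \<in> S"
      and dens: "\<And>z. z \<in> S \<Longrightarrow> (continuum_r_coreness s f x - 5 * (\<delta> / 10)) * ball_volume TYPE('a) r \<le> measure \<nu> (cball z r \<inter> S)"
      by (auto simp: good_at_def)
    have "(continuum_coreness f x - \<delta>) * ball_volume TYPE('a) r
      \<le> (continuum_r_coreness s f x - 5 * (\<delta> / 10)) * ball_volume TYPE('a) r"
      using s ball_volume_pos[OF r(1), where 'a='a] by (intro mult_right_mono) auto
    with S dens show "good_at \<nu> r (continuum_coreness f x - \<delta>) x"
      unfolding good_at_def by (blast intro: order_trans)
  qed
qed

end

lemma (in iid_sample) AE_uniform_limit_coreness: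
  assumes r: "\<And>n. 1 \<le> n \<Longrightarrow> 0 < r n" and r_lim: "r \<longlonglongrightarrow> 0"
    and rate: "filterlim (\<lambda>n. real n * r n ^ DIM('a) / ln (real n)) at_top sequentially"
  shows "AE w in M. uniform_limit UNIV
           (\<lambda>n x. 1 / (real n * ball_volume TYPE('a) (r n)) *
                  real (discrete_coreness (r n) x ((\<lambda>i. X i w) ` {1..n})))
           (continuum_coreness f) sequentially"
proof -
  let ?V = "\<lambda>n. ball_volume TYPE('a) (r n)"
  let ?D = "\<lambda>w n x. 1 / (real n * ?V n) * real (discrete_coreness (r n) x ((\<lambda>i. X i w) ` {1..n}))"
  define \<delta> where "\<delta> m = inverse (real (Suc m))" for m
  have \<delta>: "0 < \<delta> m" for m by (simp add: \<delta>_def)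
  have "\<exists>g \<eta> r0. 0 < g \<and> 0 < \<eta> \<and> 0 < r0 \<and>
    (\<forall>\<nu> r t x. cells_close g \<eta> \<nu> r \<longrightarrow> 0 < r \<longrightarrow> r < r0 \<longrightarrow>
      good_at \<nu> r t x \<longrightarrow> t \<le> continuum_coreness f x + \<delta> m) \<and>
    (\<forall>\<nu> r x. cells_close g \<eta> \<nu> r \<longrightarrow> 0 < r \<longrightarrow> r < r0 \<longrightarrow>
      good_at \<nu> r (continuum_coreness f x - \<delta> m) x)" for m
    by (rule good_levels_near_continuum_coreness[OF \<delta>[of m]]) blast
  then obtain g \<eta> r0 where c: "\<And>m. 0 < g m" "\<And>m. 0 < \<eta> m" "\<And>m. 0 < r0 m"
    and upper: "\<And>m \<nu> r t x. \<lbrakk>cells_close (g m) (\<eta> m) \<nu> r; 0 < r; r < r0 m;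
      good_at \<nu> r t x\<rbrakk> \<Longrightarrow> t \<le> continuum_coreness f x + \<delta> m"
    and lower: "\<And>m \<nu> r x. \<lbrakk>cells_close (g m) (\<eta> m) \<nu> r; 0 < r; r < r0 m\<rbrakk>
      \<Longrightarrow> good_at \<nu> r (continuum_coreness f x - \<delta> m) x"
    by metis
  \<comment> \<open>The loss of one neighbour in the discrete graph vanishes after normalisation.\<close>
  have big: "\<forall>\<^sub>F n in sequentially. 1 / (real n * ?V n) < e" if e: "0 < e" for e
  proof -
    let ?\<omega> = "ball_volume TYPE('a) 1"
    have \<omega>: "0 < ?\<omega>" by (rule ball_volume_pos) simp
    define K where "K = 1 / (e * ?\<omega>) + 1"
    have K: "0 < K" using e \<omega> by (simp add: K_def add_pos_pos)
    have "\<forall>\<^sub>F n in sequentially. K \<le> real n * r n ^ DIM('a) / ln (real n)"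
      using rate by (simp add: filterlim_at_top)
    with eventually_ge_at_top[of 3] show ?thesis
    proof eventually_elim
      case (elim n)
      have ln1: "1 \<le> ln (real n)"
      proof -
        have "exp 1 \<le> real n" using exp_le elim by linarith
        then show ?thesis using elim by (simp add: ln_ge_iff)
      qed
      have "K * 1 \<le> K * ln (real n)" using K ln1 by (intro mult_left_mono) auto
      also have "\<dots> \<le> real n * r n ^ DIM('a)" using elim ln1 by (simp add: pos_le_divide_eq)
      finally have "K \<le> real n * r n ^ DIM('a)" by simp
      then have "1 / (e * ?\<omega>) < real n * r n ^ DIM('a)" unfolding K_def by linarith
      then have "1 / e < real n * r n ^ DIM('a) * ?\<omega>" using \<omega> e by (simp add: field_simps)
      also have "\<dots> = real n * ?V n" using ball_volume_mult[where 'a='a, of "r n" 1] by simp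
      finally have *: "1 / e < real n * ?V n" .
      then have "0 < real n * ?V n" using e by (smt (verit) divide_pos_pos)
      with * e show ?case by (simp add: field_simps)
    qed
  qed
  have "AE w in M. \<forall>m. \<forall>\<^sub>F n in sequentially. cells_close (g m) (\<eta> m) (empirical n (\<lambda>i. X i w)) (r n)"
    unfolding AE_all_countable
  proof
    fix m
    show "AE w in M. \<forall>\<^sub>F n in sequentially. cells_close (g m) (\<eta> m) (empirical n (\<lambda>i. X i w)) (r n)"
      using AE_empirical_close_on_cells[OF r rate c(1)[of m] c(2)[of m]]
    proof (rule eventually_mono)
      fix w assume "\<forall>\<^sub>F n in sequentially. \<forall>j. \<bar>measure (empirical n (\<lambda>i. X i w)) (grid_cell (g m * r n) j)
        - measure law (grid_cell (g m * r n) j)\<bar> \<le> \<eta> m * r n ^ DIM('a)"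
      with eventually_ge_at_top[of 1]
      show "\<forall>\<^sub>F n in sequentially. cells_close (g m) (\<eta> m) (empirical n (\<lambda>i. X i w)) (r n)"
        by eventually_elim (simp add: cells_close_def finite_measure_empirical)
    qed
  qed
  with AE_inj_on show ?thesis
  proof eventually_elim
    case (elim w)
    show ?case
    proof (rule uniform_limitI)
      fix e :: real assume e: "0 < e"
      then have "0 < e / 2" by simp
      then obtain m where m: "\<delta> m < e / 2" using reals_Archimedean unfolding \<delta>_def by blast
      have "\<forall>\<^sub>F n in sequentially. cells_close (g m) (\<eta> m) (empirical n (\<lambda>i. X i w)) (r n)"
        using elim by blast
      moreover have "\<forall>\<^sub>F n in sequentially. r n < r0 m" by (rule order_tendstoD(2)[OF r_lim c(3)])
      ultimately show "\<forall>\<^sub>F n in sequentially. \<forall>x\<in>UNIV. dist (?D w n x) (continuum_coreness f x) < e"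
        using big[OF \<open>0 < e / 2\<close>] eventually_ge_at_top[of 1]
      proof eventually_elim
        case close: (elim n)
        let ?\<nu> = "empirical n (\<lambda>i. X i w)"
        have n: "1 \<le> n" "0 < r n" using close r by auto
        have inj: "inj_on (\<lambda>i. X i w) {1..n}" using elim(1) by (rule inj_on_subset) auto
        have \<nu>: "cells_close (g m) (\<eta> m) ?\<nu> (r n)" "0 < r n" "r n < r0 m"
          using n close by auto
        show ?case
        proof
          fix x
          have "?D w n x \<le> continuum_coreness f x + \<delta> m"
            by (rule upper[OF \<nu> good_at_discrete_coreness[OF n inj]])
          moreover have "continuum_coreness f x - \<delta> m \<le> ?D w n x + 1 / (real n * ?V n)"
            by (rule le_discrete_coreness_of_good_at[OF n inj lower[OF \<nu>]])
          moreover have "dist a b < e" if "a \<le> b + \<delta> m" "b - \<delta> m \<le> a + q" "q < e / 2" for a b q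
            using that m unfolding dist_real_def by linarith
          ultimately show "dist (?D w n x) (continuum_coreness f x) < e" using close by blast
        qed
      qed
    qed
  qed
qed

theorem theorem3p11:
  fixes M :: "'w measure"
    and X :: "nat \<Rightarrow> 'w \<Rightarrow> 'a::euclidean_space"
    and f :: "'a \<Rightarrow> real"
    and r :: "nat \<Rightarrow> real"
  assumes "prob_space M"
    and "uniformly_continuous_on UNIV f"
    and "\<And>x. 0 \<le> f x"
    and "has_bochner_integral lborel f 1"
    and "prob_space.indep_vars M (\<lambda>_. borel) X {1..}"
    and "\<And>i. 1 \<le> i \<Longrightarrow> distributed M lborel (X i) (\<lambda>x. ennreal (f x))"
    and "\<And>n. 1 \<le> n \<Longrightarrow> 0 < r n"
    and "r \<longlonglongrightarrow> 0"
    and "filterlim (\<lambda>n. real n * r n ^ DIM('a) / ln (real n)) at_top sequentially"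
  shows "AE w in M. uniform_limit UNIV
           (\<lambda>n x. 1 / (real n * ball_volume TYPE('a) (r n)) *
                  real (discrete_coreness (r n) x ((\<lambda>i. X i w) ` {1..n})))
           (continuum_coreness f) sequentially"
proof -
  interpret iid_sample M f X
    using assms(1-6)
    by (auto intro!: iid_sample.intro uniformly_continuous_density.intro iid_sample_axioms.intro)
  show ?thesis by (rule AE_uniform_limit_coreness[OF assms(7-9)])
qed

end
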